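(* Let $n \geq 1$ and let $\mathbb{G}$ be a finite reflexive digraph that triangulates an $n$-sphere. Suppose that for every $p \geq 2$ and every surjective polymorphism $f:\mathbb{G}^p \rightarrow \mathbb{G}$ there exists an embedding $e:\mathbb{G} \hookrightarrow \mathbb{G}^p$ such that the restriction of $f$ to $e(\mathbb{G})$ is onto $G$. Then $\mathbb{G}$ is S\l upecki.
   Context: A digraph $\mathbb{G}=\langle G;E\rangle$ is a finite non-empty set $G$ with a binary relation $E$; all digraphs are reflexive ($(x,x)\in E$ for all $x$). A homomorphism preserves arcs; an embedding is a homomorphism that is an isomorphism onto an induced subdigraph. $\mathbb{G}^p$ is the $p$-fold product (vertex set $G^p$, $(\bar x,\bar y)$ an arc iff $(x_i,y_i)\in E$ for all $i$). A $p$-ary polymorphism is a homomorphism $\mathbb{G}^p\to\mathbb{G}$; it is essentially unary if there are $i$ and a homomorphism $g:\mathbb{G}\to\mathbb{G}$ with $f(x_1,\dots,x_p)=g(x_i)$ for all arguments. $\mathbb{G}$ is $k$-S\l upecki if all its surjective $k$-ary polymorphisms are essentially unary, and S\l upecki if it is $k$-S\l upecki for all $k\geq 2$. The simplicial complex $K(\mathbb{G})$ has as simplices those subsets $S\subseteq G$ that are the image of a homomorphism from some finite totally ordered set (viewed as a reflexive digraph via $\leq$) to $\mathbb{G}$; $\mathbb{G}$ triangulates a space $X$ if $X$ is homeomorphic to the geometric realisation of $K(\mathbb{G})$. *)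

theory Defs
  imports "HOL-Analysis.Analysis"
begin

record 'a digraph =
  verts :: "'a set"
  arcs :: "('a \<times> 'a) set"

definition refl_digraph :: "'a digraph \<Rightarrow> bool" where
  "refl_digraph G \<longleftrightarrow>
     finite (verts G) \<and> verts G \<noteq> {} \<and> arcs G \<subseteq> verts G \<times> verts G \<and> refl_on (verts G) (arcs G)"

definition digraph_hom :: "'a digraph \<Rightarrow> 'b digraph \<Rightarrow> ('a \<Rightarrow> 'b) \<Rightarrow> bool" where
  "digraph_hom G H f \<longleftrightarrow>
     f \<in> verts G \<rightarrow> verts H \<and> (\<forall>x y. (x, y) \<in> arcs G \<longrightarrow> (f x, f y) \<in> arcs H)"

definition digraph_iso :: "'a digraph \<Rightarrow> 'b digraph \<Rightarrow> ('a \<Rightarrow> 'b) \<Rightarrow> bool" where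
  "digraph_iso G H f \<longleftrightarrow>
     bij_betw f (verts G) (verts H) \<and> digraph_hom G H f \<and> digraph_hom H G (inv_into (verts G) f)"

definition induced_subdigraph :: "'a digraph \<Rightarrow> 'a set \<Rightarrow> 'a digraph" where
  "induced_subdigraph G S = \<lparr>verts = S, arcs = arcs G \<inter> S \<times> S\<rparr>"

definition digraph_embedding :: "'a digraph \<Rightarrow> 'b digraph \<Rightarrow> ('a \<Rightarrow> 'b) \<Rightarrow> bool" where
  "digraph_embedding G H e \<longleftrightarrow>
     digraph_hom G H e \<and> (\<exists>S \<subseteq> verts H. digraph_iso G (induced_subdigraph H S) e)"

text \<open>A \<open>p\<close>-tuple is a function on the index set \<open>{..<p}\<close>, \<open>undefined\<close> elsewhere.\<close>

definition digraph_power :: "'a digraph \<Rightarrow> nat \<Rightarrow> (nat \<Rightarrow> 'a) digraph" where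
  "digraph_power G p =
     \<lparr>verts = {..<p} \<rightarrow>\<^sub>E verts G,
      arcs = {(x, y). x \<in> {..<p} \<rightarrow>\<^sub>E verts G \<and> y \<in> {..<p} \<rightarrow>\<^sub>E verts G \<and>
                      (\<forall>i<p. (x i, y i) \<in> arcs G)}\<rparr>"

definition polymorphism :: "'a digraph \<Rightarrow> nat \<Rightarrow> ((nat \<Rightarrow> 'a) \<Rightarrow> 'a) \<Rightarrow> bool" where
  "polymorphism G p f \<longleftrightarrow> digraph_hom (digraph_power G p) G f"

definition surjective_polymorphism :: "'a digraph \<Rightarrow> nat \<Rightarrow> ((nat \<Rightarrow> 'a) \<Rightarrow> 'a) \<Rightarrow> bool" where
  "surjective_polymorphism G p f \<longleftrightarrow>
     polymorphism G p f \<and> f ` verts (digraph_power G p) = verts G"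

definition essentially_unary :: "'a digraph \<Rightarrow> nat \<Rightarrow> ((nat \<Rightarrow> 'a) \<Rightarrow> 'a) \<Rightarrow> bool" where
  "essentially_unary G p f \<longleftrightarrow>
     (\<exists>i<p. \<exists>g. digraph_hom G G g \<and> (\<forall>x \<in> verts (digraph_power G p). f x = g (x i)))"

definition k_slupecki :: "nat \<Rightarrow> 'a digraph \<Rightarrow> bool" where
  "k_slupecki k G \<longleftrightarrow> (\<forall>f. surjective_polymorphism G k f \<longrightarrow> essentially_unary G k f)"

definition slupecki :: "'a digraph \<Rightarrow> bool" where
  "slupecki G \<longleftrightarrow> (\<forall>k\<ge>2. k_slupecki k G)"

text \<open>Every finite totally ordered set is isomorphic to one whose carrier consists of natural
  numbers, so restricting to such carriers loses no simplices.\<close>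

definition simplices :: "'a digraph \<Rightarrow> 'a set set" where
  "simplices G =
     {S. \<exists>(T :: nat set) R h. finite T \<and> T \<noteq> {} \<and> linear_order_on T R \<and>
           digraph_hom \<lparr>verts = T, arcs = R\<rparr> G h \<and> S = h ` T}"

text \<open>Points of the realisation are given by barycentric coordinates on the vertex set \<open>V\<close>.
  For finite \<open>V\<close>, the only case used, the topology inherited from the product \<open>\<real>\<^sup>V\<close>
  is the usual (weak) topology.\<close>

definition geometric_realisation :: "'a set \<Rightarrow> 'a set set \<Rightarrow> ('a \<Rightarrow> real) topology" where
  "geometric_realisation V K =
     subtopology (product_topology (\<lambda>_. euclideanreal) V)
       {x \<in> extensional V. (\<forall>v\<in>V. 0 \<le> x v) \<and> (\<Sum>v\<in>V. x v) = 1 \<and> {v \<in> V. x v \<noteq> 0} \<in> K}"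

definition triangulates :: "'a digraph \<Rightarrow> 'b topology \<Rightarrow> bool" where
  "triangulates G X \<longleftrightarrow> X homeomorphic_space geometric_realisation (verts G) (simplices G)"

end

theory Submission
  imports Defs "HOL-Homology.Homology"
begin

text \<open>
  A surjective homomorphism of \<open>G\<close> is an automorphism, so \<open>f \<circ> e\<close> is one, and it induces a
  map of the sphere that is not nullhomotopic. A polymorphism \<open>f\<close> induces a map \<open>F\<close> from the
  \<open>p\<close>-th power of the sphere to the sphere. If for each coordinate \<open>i\<close> some restriction of \<open>f\<close> to
  the \<open>i\<close>-th axis were not surjective, then the restrictions of \<open>F\<close> to all axes would be
  nullhomotopic, and pinching the sphere would show that \<open>F \<circ> e\<close> is nullhomotopic as well. Hence,
  for some \<open>i\<close>, fixing all coordinates but the \<open>i\<close>-th turns \<open>f\<close> into an automorphism, whatever the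
  fixed values are. Automorphisms arising from adjacent values coincide: otherwise two vertices of
  \<open>G\<close> would have the same neighbours, and the sphere could be deformed off one of them. As the
  sphere is connected, \<open>f\<close> depends on its \<open>i\<close>-th coordinate only.

  A simplex of \<open>G\<close> may admit several orderings, which need not be compatible with those of its
  neighbours, so the power of the realisation is not triangulated by the power of \<open>G\<close>. To define
  \<open>F\<close>, a point \<open>x\<close> is replaced by its decreasing family of superlevel sets. These are simplices,
  and taking a source of each gives a chain in \<open>G\<close>; chains for different points are parametrised by
  the same interval and can therefore be combined by \<open>f\<close>.
\<close>

subsection \<open>Homotopies on spheres\<close>

lemma homotopic_withI:
  assumes "continuous_map (prod_topology (top_of_set {0..1::real}) X) Y h"
    and "\<And>x. x \<in> topspace X \<Longrightarrow> h (0, x) = f x"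
    and "\<And>x. x \<in> topspace X \<Longrightarrow> h (1, x) = g x"
  shows "homotopic_with (\<lambda>_. True) X Y f g"
proof (subst homotopic_with)
  show "\<exists>h. continuous_map (prod_topology (top_of_set {0..1::real}) X) Y h \<and>
     (\<forall>x\<in>topspace X. h (0, x) = f x) \<and> (\<forall>x\<in>topspace X. h (1, x) = g x) \<and> (\<forall>t\<in>{0..1::real}. True)"
    using assms by blast
qed simp

section \<open>Inner products and projections on the sphere\<close>

definition dotp :: "nat \<Rightarrow> (nat \<Rightarrow> real) \<Rightarrow> (nat \<Rightarrow> real) \<Rightarrow> real" where
  "dotp n x y = (\<Sum>i\<le>n. x i * y i)"

lemma dotp_commute: "dotp n x y = dotp n y x"
  by (simp add: dotp_def mult.commute)

lemma dotp_linear: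
  "dotp n (\<lambda>i. a * x i + b * y i) z = a * dotp n x z + b * dotp n y z"
  "dotp n z (\<lambda>i. a * x i + b * y i) = a * dotp n z x + b * dotp n z y"
  by (simp_all add: dotp_def sum.distrib sum_distrib_left algebra_simps)

lemma topspace_nsphere_dotp:
  "x \<in> topspace (nsphere n) \<longleftrightarrow> dotp n x x = 1 \<and> (\<forall>i>n. x i = 0)"
  by (simp add: nsphere dotp_def power2_eq_square)

lemma dotp_diff_self:
  assumes "dotp n x x = 1" "dotp n y y = 1"
  shows "dotp n (\<lambda>i. x i - y i) (\<lambda>i. x i - y i) = 2 - 2 * dotp n x y"
  using assms dotp_linear[where n = n and a = 1 and x = x and b = "-1" and y = y]
    by (simp add: dotp_commute[of n y x])

text \<open>The strict case of Cauchy-Schwarz for unit vectors: the squared distance of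
  \<open>x\<close> and \<open>y\<close> is positive and equals
  \<open>2 - 2 * dotp n x y\<close>.\<close>

lemma dotp_lt_1:
  assumes "x \<in> topspace (nsphere n)" "y \<in> topspace (nsphere n)" "x \<noteq> y"
  shows "dotp n x y < 1"
proof -
  obtain i where "x i \<noteq> y i" using assms(3) by blast
  then have "i \<le> n" using assms(1,2) by (metis not_le topspace_nsphere_dotp)
  have "0 < dotp n (\<lambda>i. x i - y i) (\<lambda>i. x i - y i)"
    unfolding dotp_def
    by (rule sum_pos2[of _ i]) (use \<open>x i \<noteq> y i\<close> \<open>i \<le> n\<close> in \<open>auto simp: zero_less_mult_iff\<close>)
  then show ?thesis using assms(1,2) by (simp add: dotp_diff_self topspace_nsphere_dotp)
qed

lemma uminus_in_nsphere:
  "x \<in> topspace (nsphere n) \<Longrightarrow> (\<lambda>i. - x i) \<in> topspace (nsphere n)"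
  by (simp add: topspace_nsphere_dotp dotp_def)

lemma dotp_uminus: "dotp n (\<lambda>i. - x i) y = - dotp n x y" "dotp n x (\<lambda>i. - y i) = - dotp n x y"
  by (simp_all add: dotp_def sum_negf)

lemma continuous_map_nsphere_iff:
  "continuous_map Z (nsphere n) w \<longleftrightarrow>
     (\<forall>i. continuous_map Z euclideanreal (\<lambda>z. w z i)) \<and>
     (\<forall>z\<in>topspace Z. w z \<in> topspace (nsphere n))"
  unfolding nsphere
  by (auto simp: continuous_map_in_subtopology continuous_map_componentwise_UNIV Pi_iff)

lemma continuous_map_dotp [continuous_intros]:
  assumes "\<And>i. continuous_map Z euclideanreal (\<lambda>z. u z i)"
    and "\<And>i. continuous_map Z euclideanreal (\<lambda>z. v z i)"
  shows "continuous_map Z euclideanreal (\<lambda>z. dotp n (u z) (v z))"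
  unfolding dotp_def by (intro continuous_intros assms) auto

text \<open>The second intersection of the unit sphere with the line through its point \<open>q\<close> and \<open>w\<close>.\<close>

definition proj_from :: "nat \<Rightarrow> (nat \<Rightarrow> real) \<Rightarrow> (nat \<Rightarrow> real) \<Rightarrow> nat \<Rightarrow> real" where
  "proj_from n q w = (\<lambda>i. q i + 2 * (1 - dotp n q w) /
     dotp n (\<lambda>i. w i - q i) (\<lambda>i. w i - q i) * (w i - q i))"

text \<open>Put \<open>d = w - q\<close>. As \<open>q\<close> is a unit vector, the squared norm of
  \<open>q + s * d\<close> is \<open>1 + 2 * s * dotp n q d + s * s * dotp n d d\<close>, where
  \<open>dotp n q d = dotp n q w - 1\<close>. The factor in \<open>proj_from\<close> is the
  \<open>s\<close> for which the last two terms cancel.\<close>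

lemma proj_from_in_nsphere:
  assumes q: "q \<in> topspace (nsphere n)" and w: "\<And>i. i > n \<Longrightarrow> w i = 0"
    and 0: "dotp n (\<lambda>i. w i - q i) (\<lambda>i. w i - q i) \<noteq> 0"
  shows "proj_from n q w \<in> topspace (nsphere n)"
proof -
  define d where "d = (\<lambda>i. w i - q i)"
  define s where "s = 2 * (1 - dotp n q w) / dotp n d d"
  have qq: "dotp n q q = 1" and q0: "\<And>i. i > n \<Longrightarrow> q i = 0"
    using q by (auto simp: topspace_nsphere_dotp)
  have p: "proj_from n q w = (\<lambda>i. 1 * q i + s * d i)"
    by (simp add: proj_from_def d_def s_def)
  have qd: "dotp n q d = dotp n q w - 1"
    using dotp_linear(2)[of n q 1 w "-1" q] by (simp add: d_def qq)
  have "dotp n (\<lambda>i. 1 * q i + s * d i) (\<lambda>i. 1 * q i + s * d i) = 1 + 2 * s * dotp n q d + s * (s * dotp n d d)"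
    by (simp only: dotp_linear) (simp add: qq dotp_commute[of n d q] algebra_simps)
  also have "s * dotp n d d = 2 * (1 - dotp n q w)"
    using 0 by (simp add: s_def d_def)
  finally have "dotp n (\<lambda>i. 1 * q i + s * d i) (\<lambda>i. 1 * q i + s * d i) = 1"
    by (simp add: qd algebra_simps)
  then show ?thesis
    unfolding p topspace_nsphere_dotp by (simp add: d_def q0 w)
qed

lemma proj_from_self:
  assumes "q \<in> topspace (nsphere n)" "w \<in> topspace (nsphere n)" "w \<noteq> q"
  shows "proj_from n q w = w"
proof -
  have "dotp n w q < 1" by (rule dotp_lt_1[OF assms(2,1,3)])
  then have "2 * (1 - dotp n q w) / dotp n (\<lambda>i. w i - q i) (\<lambda>i. w i - q i) = 1"
    using assms by (simp add: dotp_diff_self topspace_nsphere_dotp dotp_commute[of n q w])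
  then show ?thesis by (simp add: proj_from_def)
qed

lemma continuous_map_proj_from:
  assumes "\<And>i. continuous_map Z euclideanreal (\<lambda>z. w z i)"
    and "\<And>z. z \<in> topspace Z \<Longrightarrow> dotp n (\<lambda>i. w z i - q i) (\<lambda>i. w z i - q i) \<noteq> 0"
  shows "continuous_map Z euclideanreal (\<lambda>z. proj_from n q (w z) i)"
  unfolding proj_from_def by (intro continuous_intros assms(1)) (use assms(2) in auto)

section \<open>Homotopies between maps into the sphere\<close>

text \<open>Where \<open>d\<close> is nonnegative, the segment from \<open>u z\<close> to
  \<open>v z\<close> is projected from \<open>q\<close> back to the sphere. It does not meet
  \<open>q\<close>, because both ends lie in the half-space of points whose inner product with
  \<open>q\<close> is below 1. Where \<open>d\<close> is nonpositive, nothing moves. Both rules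
  agree at \<open>d z = 0\<close>, because the projection fixes the points of the sphere other than
  \<open>q\<close>.\<close>

lemma homotopic_nsphere_maps_missing_point:
  assumes u: "continuous_map Z (nsphere n) u" and v: "continuous_map Z (nsphere n) v"
    and d: "continuous_map Z euclideanreal d"
    and eq: "\<And>z. z \<in> topspace Z \<Longrightarrow> d z \<le> 0 \<Longrightarrow> u z = v z"
    and q: "q \<in> topspace (nsphere n)"
    and miss: "\<And>z. z \<in> topspace Z \<Longrightarrow> d z \<ge> 0 \<Longrightarrow> u z \<noteq> q \<and> v z \<noteq> q"
  shows "homotopic_with (\<lambda>_. True) Z (nsphere n) u v"
proof -
  let ?I = "prod_topology (top_of_set {0..1::real}) Z"
  define w where "w = (\<lambda>(t, z) i. (1 - t) * u z i + t * v z i)"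
  define h where "h = (\<lambda>y. if d (snd y) \<le> 0 then u (snd y) else proj_from n q (w y))"
  have uv: "u z \<in> topspace (nsphere n)" "v z \<in> topspace (nsphere n)" if "z \<in> topspace Z" for z
    using u v that by (simp_all add: continuous_map_nsphere_iff)
  have w_ne: "dotp n (\<lambda>i. w (t, z) i - q i) (\<lambda>i. w (t, z) i - q i) \<noteq> 0"
    if t: "t \<in> {0..1}" and z: "z \<in> topspace Z" "d z \<ge> 0" for t z
  proof
    assume 0: "dotp n (\<lambda>i. w (t, z) i - q i) (\<lambda>i. w (t, z) i - q i) = 0"
    have "dotp n (w (t,z)) q = (1 - t) * dotp n (u z) q + t * dotp n (v z) q"
      by (simp add: w_def dotp_linear)
    moreover have "dotp n (u z) q < 1" "dotp n (v z) q < 1"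
      using miss[OF z] uv[OF z(1)] q dotp_lt_1 by blast+
    ultimately have lt: "dotp n (w (t,z)) q < 1"
      using convex_bound_lt[of "dotp n (u z) q" 1 "dotp n (v z) q" "1 - t" t] t by auto
    have "w (t,z) i = q i" if "i \<le> n" for i
      using 0 that unfolding dotp_def by (subst (asm) sum_nonneg_eq_0_iff) auto
    then have "dotp n (w (t,z)) q = dotp n q q" by (simp add: dotp_def)
    with lt q show False by (simp add: topspace_nsphere_dotp)
  qed
  have cu: "continuous_map ?I euclideanreal (\<lambda>y. u (snd y) i)"
    and cv: "continuous_map ?I euclideanreal (\<lambda>y. v (snd y) i)" for i
    using continuous_map_of_snd[of "top_of_set {0..1::real}" Z euclideanreal "\<lambda>z. u z i"]
      continuous_map_of_snd[of "top_of_set {0..1::real}" Z euclideanreal "\<lambda>z. v z i"]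
      u v unfolding continuous_map_nsphere_iff by (auto simp: o_def)
  have ct: "continuous_map ?I euclideanreal fst"
    using continuous_map_fst continuous_map_in_subtopology by blast
  have cd: "continuous_map ?I euclideanreal (\<lambda>y. d (snd y))"
    using continuous_map_of_snd[of "top_of_set {0..1::real}" Z euclideanreal d] d
    by (auto simp: o_def)
  have cw: "continuous_map ?I euclideanreal (\<lambda>y. w y i)" for i
    unfolding w_def case_prod_unfold by (intro continuous_intros cu cv ct)
  have w0: "w (t, z) i = 0" if "z \<in> topspace Z" "i > n" for t z i
    using uv[OF that(1)] that(2) by (simp add: w_def topspace_nsphere_dotp)
  have w_eq: "w (t, z) = u z" if "z \<in> topspace Z" "d z \<le> 0" for t z
    using eq[OF that] by (auto simp: w_def algebra_simps)
  have "continuous_map ?I (nsphere n) h"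
    unfolding h_def
  proof (rule continuous_map_cases_le)
    show "continuous_map (subtopology ?I {x \<in> topspace ?I. d (snd x) \<le> 0}) (nsphere n) (\<lambda>x. u (snd x))"
      unfolding continuous_map_nsphere_iff
      by (auto intro: continuous_map_from_subtopology cu simp: uv)
    show "continuous_map (subtopology ?I {x \<in> topspace ?I. 0 \<le> d (snd x)}) (nsphere n) (\<lambda>x. proj_from n q (w x))"
      unfolding continuous_map_nsphere_iff
    proof (intro conjI allI ballI)
      show "continuous_map (subtopology ?I {x \<in> topspace ?I. 0 \<le> d (snd x)}) euclideanreal
              (\<lambda>x. proj_from n q (w x) i)" for i
        by (rule continuous_map_proj_from[OF continuous_map_from_subtopology[OF cw]])
          (use w_ne in auto)
      fix x assume "x \<in> topspace (subtopology ?I {x \<in> topspace ?I. 0 \<le> d (snd x)})"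
      then obtain t z where "x = (t, z)" "t \<in> {0..1}" "z \<in> topspace Z" "0 \<le> d z"
        by auto
      then show "proj_from n q (w x) \<in> topspace (nsphere n)"
        using proj_from_in_nsphere[OF q w0 w_ne] by simp
    qed
  next
    fix y assume y: "y \<in> topspace ?I" "d (snd y) = 0"
    then show "u (snd y) = proj_from n q (w y)"
      using miss[of "snd y"] uv(1)[of "snd y"] w_eq[of "snd y" "fst y"]
      by (auto simp: proj_from_self q)
  qed (use cd in auto)
  moreover have "h (0, z) = u z" "h (1, z) = v z" if "z \<in> topspace Z" for z
    using that eq[OF that] miss[OF that] uv[OF that] q by (auto simp: h_def w_def proj_from_self)
  ultimately show ?thesis
    by (rule homotopic_withI)
qed

text \<open>The segment between two points of the sphere avoids the origin unless they are
  antipodal, so it can be normalised.\<close>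

lemma homotopic_nsphere_nonantipodal:
  assumes u: "continuous_map Z (nsphere n) u" and v: "continuous_map Z (nsphere n) v"
    and na: "\<And>z. z \<in> topspace Z \<Longrightarrow> u z \<noteq> (\<lambda>i. - v z i)"
  shows "homotopic_with (\<lambda>_. True) Z (nsphere n) u v"
proof -
  let ?I = "prod_topology (top_of_set {0..1::real}) Z"
  define w where "w = (\<lambda>(t, z) i. (1 - t) * u z i + t * v z i)"
  define h where "h = (\<lambda>y i. w y i / sqrt (dotp n (w y) (w y)))"
  have uv: "u z \<in> topspace (nsphere n)" "v z \<in> topspace (nsphere n)" if "z \<in> topspace Z" for z
    using u v that by (simp_all add: continuous_map_nsphere_iff)
  have w_ne: "dotp n (w (t, z)) (w (t, z)) > 0"
    if t: "t \<in> {0..1}" and z: "z \<in> topspace Z" for t z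
  proof -
    have gt: "dotp n (u z) (v z) > -1"
      using dotp_lt_1[OF uv(1)[OF z] uminus_in_nsphere[OF uv(2)[OF z]] na[OF z]]
      by (simp add: dotp_uminus)
    have "dotp n (w (t,z)) (w (t,z)) = (1 - t)\<^sup>2 + t\<^sup>2 + 2 * ((1 - t) * t) * dotp n (u z) (v z)"
      using uv[OF z] by (simp add: w_def dotp_linear topspace_nsphere_dotp dotp_commute[of n "v z" "u z"] power2_eq_square)
        (simp add: algebra_simps)
    also have "\<dots> > 0"
    proof (cases "(1 - t) * t = 0")
      case True then show ?thesis by (auto simp: add_pos_nonneg)
    next
      case False
      then have "(1 - t) * t > 0" using t by (auto simp: zero_less_mult_iff)
      then have "2 * ((1 - t) * t) * dotp n (u z) (v z) > 2 * ((1 - t) * t) * (-1)"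
        using gt by (intro mult_strict_left_mono) auto
      moreover have "(1 - t)\<^sup>2 + t\<^sup>2 + 2 * ((1 - t) * t) * (-1) = (1 - 2 * t)\<^sup>2"
        by (simp add: power2_eq_square algebra_simps)
      ultimately show ?thesis
        by (smt (verit) zero_le_power2)
    qed
    finally show ?thesis .
  qed
  have cu: "continuous_map ?I euclideanreal (\<lambda>y. u (snd y) i)"
    and cv: "continuous_map ?I euclideanreal (\<lambda>y. v (snd y) i)" for i
    using continuous_map_of_snd[of "top_of_set {0..1::real}" Z euclideanreal "\<lambda>z. u z i"]
      continuous_map_of_snd[of "top_of_set {0..1::real}" Z euclideanreal "\<lambda>z. v z i"]
      u v unfolding continuous_map_nsphere_iff by (auto simp: o_def)
  have ct: "continuous_map ?I euclideanreal fst"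
    using continuous_map_fst continuous_map_in_subtopology by blast
  have cw: "continuous_map ?I euclideanreal (\<lambda>y. w y i)" for i
    unfolding w_def case_prod_unfold by (intro continuous_intros cu cv ct)
  have w0: "w (t, z) i = 0" if "z \<in> topspace Z" "i > n" for t z i
    using uv[OF that(1)] that(2) by (simp add: w_def topspace_nsphere_dotp)
  have "continuous_map ?I (nsphere n) h"
    unfolding continuous_map_nsphere_iff
  proof (intro conjI allI ballI)
    show "continuous_map ?I euclideanreal (\<lambda>z. h z i)" for i
      unfolding h_def by (intro continuous_intros cw) (use w_ne in force)
    fix y assume y: "y \<in> topspace ?I"
    then have "dotp n (w y) (w y) > 0" using w_ne by auto
    then have "dotp n (h y) (h y) = 1"
      by (simp add: h_def dotp_def flip: sum_divide_distrib)
    then show "h y \<in> topspace (nsphere n)"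
      using y w0 by (auto simp: topspace_nsphere_dotp h_def)
  qed
  moreover have "h (0, z) = u z" "h (1, z) = v z" if "z \<in> topspace Z" for z
    using uv[OF that] by (auto simp: h_def w_def topspace_nsphere_dotp)
  ultimately show ?thesis
    by (rule homotopic_withI)
qed

text \<open>Write \<open>c\<close> for \<open>dotp n x P\<close>. If \<open>c < 0\<close>, then
  \<open>\<phi> x\<close> is the point in the span of \<open>x\<close> and \<open>P\<close> whose
  inner product with \<open>P\<close> is \<open>1 + 2 * c\<close>, which stretches the open
  hemisphere around the antipode of \<open>P\<close> over the sphere without \<open>P\<close>. The
  factor \<open>k x\<close> rescales the part of \<open>x\<close> orthogonal to \<open>P\<close> so
  that the norm is 1.\<close>

lemma nsphere_collapse_hemisphere:
  assumes P: "P \<in> topspace (nsphere n)"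
  obtains \<phi> where "homotopic_with (\<lambda>_. True) (nsphere n) (nsphere n) \<phi> id"
    and "\<And>x. x \<in> topspace (nsphere n) \<Longrightarrow> 0 \<le> dotp n x P \<Longrightarrow> \<phi> x = P"
proof -
  define m where "m = (\<lambda>x. max 0 (- dotp n x P))"
  define k where "k = (\<lambda>x. sqrt (4 * m x / (1 + m x)))"
  define \<phi> where "\<phi> = (\<lambda>x i. (1 - 2 * m x - k x * dotp n x P) * P i + k x * x i)"
  have m0: "m x \<ge> 0" for x by (simp add: m_def)
  have PP: "dotp n P P = 1" using P by (simp add: topspace_nsphere_dotp)
  have \<phi>P: "\<phi> x = P" if "0 \<le> dotp n x P" for x
    using that by (simp add: \<phi>_def k_def m_def)
  have cx: "continuous_map (nsphere n) euclideanreal (\<lambda>x. x i)" for i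
    by (rule continuous_map_nsphere_projection)
  have cm: "continuous_map (nsphere n) euclideanreal m"
    unfolding m_def by (intro continuous_intros cx) auto
  have ck: "continuous_map (nsphere n) euclideanreal k"
    unfolding k_def by (intro continuous_intros cm) (use m0 in \<open>auto simp: add_nonneg_eq_0_iff\<close>)
  have cphi: "continuous_map (nsphere n) (nsphere n) \<phi>"
    unfolding continuous_map_nsphere_iff
  proof (intro conjI allI ballI)
    show "continuous_map (nsphere n) euclideanreal (\<lambda>z. \<phi> z i)" for i
      unfolding \<phi>_def by (intro continuous_intros cm ck cx) auto
    fix x assume x: "x \<in> topspace (nsphere n)"
    show "\<phi> x \<in> topspace (nsphere n)"
    proof (cases "0 \<le> dotp n x P")
      case True then show ?thesis by (simp add: \<phi>P P)
    next
      case False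
      define c where "c = dotp n x P"
      have c: "c < 0" "m x = - c" using False by (auto simp: c_def m_def)
      have kk: "k x * k x * (1 - c) = - 4 * c"
        using c by (simp add: k_def)
      have "dotp n (\<phi> x) (\<phi> x) = (1 - 2 * m x - k x * c)\<^sup>2 + 2 * (1 - 2 * m x - k x * c) * k x * c + k x * k x"
        using x by (simp add: \<phi>_def dotp_linear PP c_def dotp_commute[of n P x] topspace_nsphere_dotp
            power2_eq_square) (simp add: algebra_simps)
      also have "\<dots> = (1 + 2 * c)\<^sup>2 + (k x * k x * (1 - c)) * (1 + c)"
        by (simp add: c power2_eq_square algebra_simps)
      also have "\<dots> = 1" unfolding kk by (simp add: power2_eq_square algebra_simps)
      finally show ?thesis
        using x P by (simp add: topspace_nsphere_dotp \<phi>_def)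
    qed
  qed
  have "homotopic_with (\<lambda>_. True) (nsphere n) (nsphere n) \<phi> id"
  proof (rule homotopic_nsphere_nonantipodal[OF cphi])
    fix x assume x: "x \<in> topspace (nsphere n)"
    show "\<phi> x \<noteq> (\<lambda>i. - id x i)"
    proof
      assume "\<phi> x = (\<lambda>i. - id x i)"
      then have a: "\<phi> x = (\<lambda>i. - x i)" by simp
      show False
      proof (cases "0 \<le> dotp n x P")
        case True
        then have "P = (\<lambda>i. - x i)" using a \<phi>P by metis
        then have "dotp n x P = - 1"
          using x by (simp add: dotp_uminus topspace_nsphere_dotp)
        then show False using True by simp
      next
        case False
        define c where "c = dotp n x P"
        have c: "c < 0" "m x = - c" using False by (auto simp: c_def m_def)
        have k0: "k x \<ge> 0" using m0 by (simp add: k_def)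
        \<comment> \<open>If \<open>\<phi> x\<close> were antipodal to \<open>x\<close>, the inner
          product with \<open>P\<close> would determine \<open>c\<close>, and the inner product with
          \<open>x\<close> would then make \<open>k x\<close> negative.\<close>
        have "dotp n (\<phi> x) P = 1 + 2 * c"
          by (simp add: \<phi>_def dotp_linear PP c flip: c_def)
        moreover have "dotp n (\<phi> x) P = - c" unfolding a by (simp add: dotp_uminus c_def)
        ultimately have c3: "c = - 1 / 3" by simp
        have "- 1 = dotp n (\<phi> x) x" unfolding a using x by (simp add: dotp_uminus topspace_nsphere_dotp)
        also have "\<dots> = (1 - 2 * m x - k x * c) * c + k x"
          using x by (simp add: \<phi>_def dotp_linear c_def dotp_commute[of n P x] topspace_nsphere_dotp)
        also have "\<dots> = - 1 / 9 + 8 / 9 * k x" by (simp add: c(2) c3 algebra_simps)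
        finally show False using k0 by simp
      qed
    qed
  qed auto
  then show thesis using that \<phi>P by blast
qed

text \<open>Two constant maps that miss a common point are homotopic, and such a homotopy contains a
  path.\<close>

lemma path_connected_space_nsphere:
  assumes "n \<ge> 1"
  shows "path_connected_space (nsphere n)"
  unfolding path_connected_space_iff_path_component
proof (intro ballI)
  fix P Q assume PQ: "P \<in> topspace (nsphere n)" "Q \<in> topspace (nsphere n)"
  \<comment> \<open>Of three distinct points, at least one differs from both \<open>P\<close> and
    \<open>Q\<close>. The third candidate lies on the axis with index 1, which exists as
    \<open>n \<ge> 1\<close>.\<close>
  define e where "e = (\<lambda>(j::nat) (s::real) i. if i = j then s else 0)"
  have e: "e j s \<in> topspace (nsphere n)" if "j \<le> 1" "s * s = 1" for j s
    using that assms by (simp add: topspace_nsphere_dotp e_def dotp_def if_distrib[of "\<lambda>a. a * _"] cong: if_cong)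
  have "e 0 1 \<noteq> e 0 (-1)" "e 0 1 \<noteq> e 1 1" "e 0 (-1) \<noteq> e 1 1"
    by (auto simp: e_def fun_eq_iff split: if_splits intro!: exI[of _ 0])
  then have "\<exists>q\<in>{e 0 1, e 0 (-1), e 1 1}. q \<noteq> P \<and> q \<noteq> Q"
    by (cases "e 0 1 = P"; cases "e 0 1 = Q"; cases "e 0 (-1) = P"; cases "e 0 (-1) = Q") force+
  moreover have "{e 0 1, e 0 (-1), e 1 1} \<subseteq> topspace (nsphere n)"
    by (simp add: e)
  ultimately obtain q where q: "q \<in> topspace (nsphere n)" "q \<noteq> P" "q \<noteq> Q"
    by blast
  have "homotopic_with (\<lambda>_. True) (nsphere n) (nsphere n) (\<lambda>_. P) (\<lambda>_. Q)"
    by (rule homotopic_nsphere_maps_missing_point[where d = "\<lambda>_. 1" and q = q]) (use PQ q in auto)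
  then show "path_component_of (nsphere n) P Q"
    by (simp add: homotopic_constant_maps)
qed

subsection \<open>Maps from powers of a sphere\<close>

text \<open>The homotopies of all coordinates run simultaneously: they form a homotopy of product
  maps, which is then restricted to the diagonal.\<close>

lemma homotopic_with_family_compose:
  assumes F: "continuous_map (product_topology Y I) X F"
    and h: "\<And>j. j \<in> I \<Longrightarrow> homotopic_with (\<lambda>_. True) Z (Y j) (\<alpha> j) (\<beta> j)"
  shows "homotopic_with (\<lambda>_. True) Z X (\<lambda>z. F (\<lambda>j\<in>I. \<alpha> j z)) (\<lambda>z. F (\<lambda>j\<in>I. \<beta> j z))"
proof -
  have "homotopic_with (\<lambda>_. True) (product_topology (\<lambda>_. Z) I) (product_topology Y I)
          (\<lambda>z. \<lambda>j\<in>I. \<alpha> j (z j)) (\<lambda>z. \<lambda>j\<in>I. \<beta> j (z j))"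
    by (rule homotopic_with_product_topology[OF h]) auto
  moreover have "continuous_map Z (product_topology (\<lambda>_. Z) I) (\<lambda>z. \<lambda>j\<in>I. z)"
    by (auto simp: continuous_map_componentwise)
  ultimately have "homotopic_with (\<lambda>_. True) Z (product_topology Y I)
      ((\<lambda>z. \<lambda>j\<in>I. \<alpha> j (z j)) \<circ> (\<lambda>z. \<lambda>j\<in>I. z)) ((\<lambda>z. \<lambda>j\<in>I. \<beta> j (z j)) \<circ> (\<lambda>z. \<lambda>j\<in>I. z))"
    by (rule homotopic_with_compose_continuous_map_right) simp
  then have "homotopic_with (\<lambda>_. True) Z X
      (F \<circ> ((\<lambda>z. \<lambda>j\<in>I. \<alpha> j (z j)) \<circ> (\<lambda>z. \<lambda>j\<in>I. z))) (F \<circ> ((\<lambda>z. \<lambda>j\<in>I. \<beta> j (z j)) \<circ> (\<lambda>z. \<lambda>j\<in>I. z)))"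
    by (rule homotopic_with_compose_continuous_map_left[OF _ F]) simp
  then show ?thesis
    by (simp add: o_def cong: restrict_cong)
qed

section \<open>Spaces homeomorphic to a sphere\<close>

locale topological_sphere =
  fixes X :: "'x topology" and n :: nat
  assumes n: "n \<ge> 1" and homeo: "nsphere n homeomorphic_space X"
begin

lemma path_connected: "path_connected_space X"
  using homeo n homeomorphic_path_connected_space path_connected_space_nsphere by blast

lemma not_contractible: "\<not> contractible_space X"
  using homeo homeomorphic_space_contractibility non_contractible_space_nsphere by blast

lemma homotopic_consts:
  "a \<in> topspace X \<Longrightarrow> b \<in> topspace X \<Longrightarrow> homotopic_with (\<lambda>_. True) Z X (\<lambda>_. a) (\<lambda>_. b)"
  using path_connected by (simp add: homotopic_constant_maps path_connected_space_iff_path_component)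

lemma homotopic_maps_missing_point:
  assumes u: "continuous_map Z X u" and v: "continuous_map Z X v"
    and d: "continuous_map Z euclideanreal d"
    and eq: "\<And>z. z \<in> topspace Z \<Longrightarrow> d z \<le> 0 \<Longrightarrow> u z = v z"
    and q: "q \<in> topspace X"
    and miss: "\<And>z. z \<in> topspace Z \<Longrightarrow> d z \<ge> 0 \<Longrightarrow> u z \<noteq> q \<and> v z \<noteq> q"
  shows "homotopic_with (\<lambda>_. True) Z X u v"
proof -
  obtain f g where "homeomorphic_maps (nsphere n) X f g"
    using homeo homeomorphic_space_def by blast
  then have f: "continuous_map (nsphere n) X f" and g: "continuous_map X (nsphere n) g"
    and gf: "\<And>x. x \<in> topspace X \<Longrightarrow> f (g x) = x"
    by (auto simp: homeomorphic_maps_def)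
  have uv: "u z \<in> topspace X" "v z \<in> topspace X" if "z \<in> topspace Z" for z
    using u v that by (auto simp: continuous_map_def)
  have "homotopic_with (\<lambda>_. True) Z (nsphere n) (g \<circ> u) (g \<circ> v)"
  proof (rule homotopic_nsphere_maps_missing_point[where d = d and q = "g q"])
    show "g q \<in> topspace (nsphere n)" using g q by (auto simp: continuous_map_def)
    show "(g \<circ> u) z \<noteq> g q \<and> (g \<circ> v) z \<noteq> g q" if "z \<in> topspace Z" "0 \<le> d z" for z
      using miss[OF that] uv[OF that(1)] gf q by (metis comp_apply)
  qed (use u v d g eq continuous_map_compose in auto)
  then have "homotopic_with (\<lambda>_. True) Z X (f \<circ> (g \<circ> u)) (f \<circ> (g \<circ> v))"
    by (rule homotopic_with_compose_continuous_map_left[OF _ f]) simp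
  then show ?thesis
    by (rule homotopic_with_eq) (auto simp: gf uv)
qed

lemma nullhomotopic_missing_point:
  assumes "continuous_map Z X u" "q \<in> topspace X" "\<And>z. z \<in> topspace Z \<Longrightarrow> u z \<noteq> q"
    and "a \<in> topspace X"
  shows "homotopic_with (\<lambda>_. True) Z X u (\<lambda>_. a)"
proof -
  \<comment> \<open>A space with at most one point is contractible, so some constant map misses
    \<open>q\<close> as well.\<close>
  obtain b where b: "b \<in> topspace X" "b \<noteq> q"
    using not_contractible contractible_space_subset_singleton[of X q] by auto
  have "homotopic_with (\<lambda>_. True) Z X u (\<lambda>_. b)"
    by (rule homotopic_maps_missing_point[where d = "\<lambda>_. 1" and q = q]) (use assms b in auto)
  from homotopic_with_trans[OF this homotopic_consts[OF b(1) assms(4)]] show ?thesis .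
qed

text \<open>This replaces the pinching of an equator: both maps are homotopic to the identity, and
  on each of the two halves cut out by \<open>d\<close> one of them is constant. They collapse
  hemispheres around antipodal points.\<close>

lemma collapse_hemispheres:
  assumes P: "P \<in> topspace X"
  obtains d \<phi> \<psi> P' where "continuous_map X euclideanreal d"
    "homotopic_with (\<lambda>_. True) X X \<phi> id" "homotopic_with (\<lambda>_. True) X X \<psi> id" "P' \<in> topspace X"
    "\<And>x. x \<in> topspace X \<Longrightarrow> d x \<ge> 0 \<Longrightarrow> \<phi> x = P"
    "\<And>x. x \<in> topspace X \<Longrightarrow> d x \<le> 0 \<Longrightarrow> \<psi> x = P'"
proof -
  obtain f g where "homeomorphic_maps (nsphere n) X f g"
    using homeo homeomorphic_space_def by blast
  then have f: "continuous_map (nsphere n) X f" and g: "continuous_map X (nsphere n) g"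
    and gf: "\<And>x. x \<in> topspace X \<Longrightarrow> f (g x) = x"
    by (auto simp: homeomorphic_maps_def)
  have gx: "g x \<in> topspace (nsphere n)" if "x \<in> topspace X" for x
    using g that by (auto simp: continuous_map_def)
  define Q where "Q = (\<lambda>i. - g P i)"
  have Q: "Q \<in> topspace (nsphere n)"
    using uminus_in_nsphere gx P by (auto simp: Q_def)
  obtain \<phi> where \<phi>: "homotopic_with (\<lambda>_. True) (nsphere n) (nsphere n) \<phi> id"
     "\<And>x. x \<in> topspace (nsphere n) \<Longrightarrow> 0 \<le> dotp n x (g P) \<Longrightarrow> \<phi> x = g P"
    using nsphere_collapse_hemisphere[OF gx[OF P]] by blast
  obtain \<psi> where \<psi>: "homotopic_with (\<lambda>_. True) (nsphere n) (nsphere n) \<psi> id"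
     "\<And>x. x \<in> topspace (nsphere n) \<Longrightarrow> 0 \<le> dotp n x Q \<Longrightarrow> \<psi> x = Q"
    using nsphere_collapse_hemisphere[OF Q] by blast
  have transfer: "homotopic_with (\<lambda>_. True) X X (f \<circ> (h \<circ> g)) id"
    if "homotopic_with (\<lambda>_. True) (nsphere n) (nsphere n) h id" for h
  proof -
    have "homotopic_with (\<lambda>_. True) X X (f \<circ> (h \<circ> g)) (f \<circ> (id \<circ> g))"
      by (rule homotopic_with_compose_continuous_map_left[OF homotopic_with_compose_continuous_map_right])
        (use that f g in auto)
    then show ?thesis by (rule homotopic_with_eq) (auto simp: gf)
  qed
  show thesis
  proof
    have "continuous_map X euclideanreal (\<lambda>x. g x i)" for i
      using g by (simp add: continuous_map_nsphere_iff)
    then show "continuous_map X euclideanreal (\<lambda>x. dotp n (g x) (g P))"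
      by (intro continuous_intros) auto
    show "f Q \<in> topspace X" using f Q by (auto simp: continuous_map_def)
    show "(f \<circ> (\<phi> \<circ> g)) x = P" if "x \<in> topspace X" "dotp n (g x) (g P) \<ge> 0" for x
      using \<phi>(2)[OF gx[OF that(1)] that(2)] gf P by simp
    show "(f \<circ> (\<psi> \<circ> g)) x = f Q" if "x \<in> topspace X" "dotp n (g x) (g P) \<le> 0" for x
      using \<psi>(2)[OF gx[OF that(1)]] that(2) by (simp add: Q_def dotp_uminus)
  qed (use transfer[OF \<phi>(1)] transfer[OF \<psi>(1)] in \<open>auto simp: o_def\<close>)
qed

text \<open>Up to homotopy, \<open>\<alpha> i\<close> may be taken constant on one hemisphere and all other
  \<open>\<alpha> j\<close> constant on the opposite one. There \<open>F\<close> runs through a punctured sphere only, so the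
  values of \<open>\<alpha> i\<close> can be contracted without moving anything on the first hemisphere.\<close>

lemma homotopic_replace_coordinate_by_const:
  assumes F: "continuous_map (product_topology (\<lambda>_. X) I) X F"
    and \<alpha>: "\<And>j. j \<in> I \<Longrightarrow> continuous_map X X (\<alpha> j)"
    and i: "i \<in> I" and P: "P \<in> topspace X" and q: "q \<in> topspace X" and c: "c \<in> topspace X"
    and miss: "\<And>x. x \<in> topspace X \<Longrightarrow> F (\<lambda>j\<in>I. if j = i then x else \<alpha> j P) \<noteq> q"
  shows "homotopic_with (\<lambda>_. True) X X (\<lambda>x. F (\<lambda>j\<in>I. \<alpha> j x)) (\<lambda>x. F (\<lambda>j\<in>I. if j = i then c else \<alpha> j x))"
proof -
  obtain d \<phi> \<psi> P' where d: "continuous_map X euclideanreal d"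
    and \<phi>: "homotopic_with (\<lambda>_. True) X X \<phi> id" and \<psi>: "homotopic_with (\<lambda>_. True) X X \<psi> id"
    and P': "P' \<in> topspace X"
    and \<phi>P: "\<And>x. x \<in> topspace X \<Longrightarrow> d x \<ge> 0 \<Longrightarrow> \<phi> x = P"
    and \<psi>P: "\<And>x. x \<in> topspace X \<Longrightarrow> d x \<le> 0 \<Longrightarrow> \<psi> x = P'"
    using collapse_hemispheres[OF P] by blast
  \<comment> \<open>\<open>\<psi>\<close> enters coordinate \<open>i\<close> and
    \<open>\<phi>\<close> all others. For \<open>d x \<le> 0\<close> coordinate \<open>i\<close> is
    constant, so \<open>H\<close> and \<open>H'\<close> agree. For \<open>d x \<ge> 0\<close> the
    other coordinates are fixed at their values for \<open>P\<close>, so both maps only take values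
    of \<open>F\<close> on one axis and miss \<open>q\<close>.\<close>
  define H where "H = (\<lambda>x. F (\<lambda>j\<in>I. if j = i then \<alpha> j (\<psi> x) else \<alpha> j (\<phi> x)))"
  define H' where "H' = (\<lambda>x. F (\<lambda>j\<in>I. if j = i then \<alpha> j P' else \<alpha> j (\<phi> x)))"
  have comp: "homotopic_with (\<lambda>_. True) X X (\<alpha> j) (\<lambda>x. \<alpha> j (h x))"
    if "j \<in> I" "homotopic_with (\<lambda>_. True) X X h id" for j h
    using homotopic_with_compose_continuous_map_left[OF homotopic_with_symD[OF that(2)] \<alpha>[OF that(1)], of "\<lambda>_. True"]
    by (simp add: o_def)
  have 1: "homotopic_with (\<lambda>_. True) X X (\<lambda>x. F (\<lambda>j\<in>I. \<alpha> j x)) H"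
    unfolding H_def
  proof (rule homotopic_with_family_compose[OF F])
    fix j assume "j \<in> I"
    then show "homotopic_with (\<lambda>_. True) X X (\<alpha> j) (\<lambda>x. if j = i then \<alpha> j (\<psi> x) else \<alpha> j (\<phi> x))"
      using comp[OF _ \<phi>] comp[OF _ \<psi>] by (cases "j = i") simp_all
  qed
  have \<alpha>P': "\<alpha> i P' \<in> topspace X" using \<alpha>[OF i] P' by (auto simp: continuous_map_def)
  have 3: "homotopic_with (\<lambda>_. True) X X H' (\<lambda>x. F (\<lambda>j\<in>I. if j = i then c else \<alpha> j x))"
    unfolding H'_def
  proof (rule homotopic_with_family_compose[OF F])
    fix j assume "j \<in> I"
    then show "homotopic_with (\<lambda>_. True) X X (\<lambda>x. if j = i then \<alpha> j P' else \<alpha> j (\<phi> x)) (\<lambda>x. if j = i then c else \<alpha> j x)"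
      using homotopic_with_symD[OF comp[OF _ \<phi>]] homotopic_consts[OF \<alpha>P' c] by (cases "j = i") simp_all
  qed
  have "homotopic_with (\<lambda>_. True) X X H H'"
  proof (rule homotopic_maps_missing_point[OF _ _ d _ q])
    show "continuous_map X X H" "continuous_map X X H'"
      using homotopic_with_imp_continuous_maps[OF 1] homotopic_with_imp_continuous_maps[OF 3] by simp_all
    show "H z = H' z" if "z \<in> topspace X" "d z \<le> 0" for z
      unfolding H_def H'_def \<psi>P[OF that] ..
    show "H z \<noteq> q \<and> H' z \<noteq> q" if "z \<in> topspace X" "0 \<le> d z" for z
    proof -
      have "\<psi> z \<in> topspace X"
        using homotopic_with_imp_continuous_maps[OF \<psi>] that(1) by (auto simp: continuous_map_def)
      then have "\<alpha> i (\<psi> z) \<in> topspace X" using \<alpha>[OF i] by (auto simp: continuous_map_def)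
      then have "F (\<lambda>j\<in>I. if j = i then \<alpha> i (\<psi> z) else \<alpha> j P) \<noteq> q"
        "F (\<lambda>j\<in>I. if j = i then \<alpha> i P' else \<alpha> j P) \<noteq> q"
        using miss \<alpha>P' by blast+
      moreover have "H z = F (\<lambda>j\<in>I. if j = i then \<alpha> i (\<psi> z) else \<alpha> j P)"
        "H' z = F (\<lambda>j\<in>I. if j = i then \<alpha> i P' else \<alpha> j P)"
        unfolding H_def H'_def \<phi>P[OF that] by (auto intro!: arg_cong[of _ _ F])
      ultimately show ?thesis by simp
    qed
  qed
  from homotopic_with_trans[OF homotopic_with_trans[OF 1 this] 3] show ?thesis .
qed

text \<open>The coordinates are replaced by the constant \<open>c\<close> one after another. Missed
  points are provided for axes whose fixed coordinates lie in \<open>V\<close>; since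
  \<open>c\<close> and all \<open>\<alpha> j P\<close> lie in \<open>V\<close>, this covers every
  stage.\<close>

lemma nullhomotopic_if_all_axes_miss:
  fixes p :: nat
  assumes F: "continuous_map (product_topology (\<lambda>_. X) {..<p}) X F"
    and \<alpha>: "\<And>j. j < p \<Longrightarrow> continuous_map X X (\<alpha> j)"
    and P: "P \<in> topspace X" and V: "V \<subseteq> topspace X" and c: "c \<in> V"
    and \<alpha>V: "\<And>j. j < p \<Longrightarrow> \<alpha> j P \<in> V"
    and miss: "\<And>i y. i < p \<Longrightarrow> y \<in> {..<p} \<rightarrow> V \<Longrightarrow>
        \<exists>q\<in>topspace X. \<forall>x\<in>topspace X. F (\<lambda>j\<in>{..<p}. if j = i then x else y j) \<noteq> q"
  shows "homotopic_with (\<lambda>_. True) X X (\<lambda>x. F (\<lambda>j\<in>{..<p}. \<alpha> j x)) (\<lambda>x. F (\<lambda>j\<in>{..<p}. c))"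
proof -
  have cX: "c \<in> topspace X" using V c by blast
  have *: "homotopic_with (\<lambda>_. True) X X (\<lambda>x. F (\<lambda>j\<in>{..<p}. \<alpha> j x))
      (\<lambda>x. F (\<lambda>j\<in>{..<p}. if j < k then c else \<alpha> j x))" if "k \<le> p" for k
    using that
  proof (induction k)
    case 0
    have "homotopic_with (\<lambda>_. True) X X (\<lambda>x. F (\<lambda>j\<in>{..<p}. \<alpha> j x)) (\<lambda>x. F (\<lambda>j\<in>{..<p}. \<alpha> j x))"
      by (rule homotopic_with_family_compose[OF F]) (simp add: \<alpha>)
    then show ?case by (simp only: not_less0 if_False)
  next
    case (Suc k)
    define \<beta> where "\<beta> = (\<lambda>j x. if j < k then c else \<alpha> j x)"
    have \<beta>: "continuous_map X X (\<beta> j)" if "j < p" for j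
      using that \<alpha> cX by (simp add: \<beta>_def)
    have "(\<lambda>j. \<beta> j P) \<in> {..<p} \<rightarrow> V" using \<alpha>V c by (auto simp: \<beta>_def)
    then obtain q where q: "q \<in> topspace X"
      "\<And>x. x \<in> topspace X \<Longrightarrow> F (\<lambda>j\<in>{..<p}. if j = k then x else \<beta> j P) \<noteq> q"
      using miss[of k "\<lambda>j. \<beta> j P"] Suc.prems by auto
    have 1: "homotopic_with (\<lambda>_. True) X X (\<lambda>x. F (\<lambda>j\<in>{..<p}. \<beta> j x))
        (\<lambda>x. F (\<lambda>j\<in>{..<p}. if j = k then c else \<beta> j x))"
      by (rule homotopic_replace_coordinate_by_const[where \<alpha> = \<beta>, OF F _ _ P q(1) cX])
        (use \<beta> Suc.prems q(2) in auto)
    have 2: "(\<lambda>j\<in>{..<p}. if j = k then c else \<beta> j x) = (\<lambda>j\<in>{..<p}. if j < Suc k then c else \<alpha> j x)" for x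
      by (auto simp: \<beta>_def fun_eq_iff)
    have 3: "homotopic_with (\<lambda>_. True) X X (\<lambda>x. F (\<lambda>j\<in>{..<p}. \<alpha> j x)) (\<lambda>x. F (\<lambda>j\<in>{..<p}. \<beta> j x))"
      using Suc.IH Suc.prems unfolding \<beta>_def by linarith
    show ?case
      using homotopic_with_trans[OF 3 1] unfolding 2 .
  qed
  have "(\<lambda>j\<in>{..<p}. if j < p then c else \<alpha> j x) = (\<lambda>j\<in>{..<p}. c)" for x
    by auto
  with *[OF order_refl] show ?thesis by (simp only:)
qed

end

subsection \<open>Geometric realisation\<close>

lemma continuous_map_Max_insert [continuous_intros]:
  fixes f :: "'k \<Rightarrow> 'z \<Rightarrow> real"
  assumes "finite K" "\<And>k. k \<in> K \<Longrightarrow> continuous_map Z euclideanreal (f k)"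
  shows "continuous_map Z euclideanreal (\<lambda>z. Max (insert c ((\<lambda>k. f k z) ` K)))"
  using assms
proof (induction K rule: finite_induct)
  case (insert k K)
  then have "Max (insert c ((\<lambda>k. f k z) ` insert k K)) = max (f k z) (Max (insert c ((\<lambda>k. f k z) ` K)))" for z
    by (simp add: insert_commute[of c])
  then show ?case
    using insert by (auto intro!: continuous_map_real_max)
qed auto

lemma continuous_map_Min_insert [continuous_intros]:
  fixes f :: "'k \<Rightarrow> 'z \<Rightarrow> real"
  assumes "finite K" "\<And>k. k \<in> K \<Longrightarrow> continuous_map Z euclideanreal (f k)"
  shows "continuous_map Z euclideanreal (\<lambda>z. Min (insert c ((\<lambda>k. f k z) ` K)))"
  using assms
proof (induction K rule: finite_induct)
  case (insert k K)
  then have "Min (insert c ((\<lambda>k. f k z) ` insert k K)) = min (f k z) (Min (insert c ((\<lambda>k. f k z) ` K)))" for z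
    by (simp add: insert_commute[of c])
  then show ?case
    using insert by (auto intro!: continuous_map_real_min)
qed auto

text \<open>The threshold set of \<open>t\<close> is \<open>A\<close> iff \<open>t\<close> is at
  least every value outside \<open>A\<close> and below every value in \<open>A\<close>. The inserted
  0 and 1 are the ends of the parameter interval.\<close>

lemma threshold_cell_eq:
  fixes u :: "'k \<Rightarrow> real"
  assumes "finite I" "A \<subseteq> I"
  shows "{t. 0 \<le> t \<and> t < 1 \<and> {k \<in> I. t < u k} = A} = {Max (insert 0 (u ` (I - A)))..<Min (insert 1 (u ` A))}"
proof -
  have "finite A" using assms finite_subset by blast
  then have "t \<in> {Max (insert 0 (u ` (I - A)))..<Min (insert 1 (u ` A))} \<longleftrightarrow>
     0 \<le> t \<and> t < 1 \<and> (\<forall>k\<in>I - A. u k \<le> t) \<and> (\<forall>k\<in>A. t < u k)" for t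
    using assms(1) by auto
  moreover have "{k \<in> I. t < u k} = A \<longleftrightarrow> (\<forall>k\<in>I - A. u k \<le> t) \<and> (\<forall>k\<in>A. t < u k)" for t
    using assms(2) by force
  ultimately show ?thesis by auto
qed

lemma threshold_level_set_eq:
  assumes "\<And>t. t \<in> {0..<1::real} \<Longrightarrow> \<tau> t = T {k \<in> I. t < u k}"
  shows "{t \<in> {0..<1}. \<tau> t = v} = (\<Union>A\<in>{A \<in> Pow I. T A = v}. {t \<in> {0..<1}. {k \<in> I. t < u k} = A})"
  using assms by auto

lemma threshold_level_set_measurable:
  fixes u :: "'k \<Rightarrow> real"
  assumes "finite I" "\<And>t. t \<in> {0..<1::real} \<Longrightarrow> \<tau> t = T {k \<in> I. t < u k}"
  shows "{t \<in> {0..<1}. \<tau> t = v} \<in> sets lborel"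
proof -
  have "(\<Union>A\<in>{A \<in> Pow I. T A = v}. {t \<in> {0..<1}. {k \<in> I. t < u k} = A}) \<in> sets lborel"
    by (rule sets.finite_UN) (use assms(1) in \<open>auto simp: threshold_cell_eq\<close>)
  then show ?thesis using threshold_level_set_eq[of \<tau> T I u v] assms(2) by simp
qed

text \<open>The level set is a disjoint union of half-open intervals, one for each \<open>A\<close>
  with \<open>T A = v\<close>; an interval whose ends are in the wrong order is empty, hence the
  \<open>max\<close>. The right-hand side is visibly continuous in \<open>u\<close>.\<close>

lemma measure_threshold_level_set:
  fixes u :: "'k \<Rightarrow> real"
  assumes "finite I" "\<And>t. t \<in> {0..<1::real} \<Longrightarrow> \<tau> t = T {k \<in> I. t < u k}"
  shows "measure lborel {t \<in> {0..<1}. \<tau> t = v} =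
    (\<Sum>A | A \<in> Pow I \<and> T A = v. max 0 (Min (insert 1 (u ` A)) - Max (insert 0 (u ` (I - A)))))"
proof -
  have eq: "{t \<in> {0..<1}. \<tau> t = v} = (\<Union>A\<in>{A \<in> Pow I. T A = v}. {t \<in> {0..<1}. {k \<in> I. t < u k} = A})"
    by (rule threshold_level_set_eq) (use assms(2) in simp)
  have "measure lborel {t \<in> {0..<1}. \<tau> t = v} =
      (\<Sum>A\<in>{A \<in> Pow I. T A = v}. measure lborel {t \<in> {0..<1::real}. {k \<in> I. t < u k} = A})"
    unfolding eq
  proof (rule measure_finite_Union)
    show "(\<lambda>A. {t \<in> {0..<1}. {k \<in> I. t < u k} = A}) ` {A \<in> Pow I. T A = v} \<subseteq> sets lborel"
      using assms(1) by (auto simp: threshold_cell_eq)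
    show "disjoint_family_on (\<lambda>A. {t \<in> {0..<1}. {k \<in> I. t < u k} = A}) {A \<in> Pow I. T A = v}"
      by (auto simp: disjoint_family_on_def)
    show "emeasure lborel {t \<in> {0..<1::real}. {k \<in> I. t < u k} = A} \<noteq> \<infinity>"
      if "A \<in> {A \<in> Pow I. T A = v}" for A
    proof -
      have "emeasure lborel {a..<b::real} \<noteq> \<infinity>" for a b by (cases "a \<le> b") auto
      then show ?thesis using that assms(1) by (simp add: threshold_cell_eq)
    qed
  qed (use assms(1) in auto)
  moreover have "measure lborel {a..<b::real} = max 0 (b - a)" for a b
    by (cases "a \<le> b") auto
  then have "(\<Sum>A\<in>{A \<in> Pow I. T A = v}. measure lborel {t \<in> {0..<1::real}. {k \<in> I. t < u k} = A}) =
     (\<Sum>A | A \<in> Pow I \<and> T A = v. max 0 (Min (insert 1 (u ` A)) - Max (insert 0 (u ` (I - A)))))"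
    using assms(1) by (intro sum.cong) (simp_all add: threshold_cell_eq)
  ultimately show ?thesis by (simp only:)
qed

section \<open>Simplices as sets ranked by real numbers\<close>

text \<open>The rank of a vertex counts the elements of \<open>T\<close> up to a chosen preimage. In
  a linear order a smaller element has strictly fewer elements up to it, so ranks compare
  preimages.\<close>

lemma simplices_imp_ranking:
  assumes "S \<in> simplices G"
  shows "finite S" "S \<noteq> {}" "S \<subseteq> verts G"
    and "\<exists>r :: 'a \<Rightarrow> real. \<forall>a\<in>S. \<forall>b\<in>S. r a \<le> r b \<longrightarrow> (a, b) \<in> arcs G"
proof -
  obtain T :: "nat set" and R h where T: "finite T" "T \<noteq> {}" "linear_order_on T R"
    and h: "digraph_hom \<lparr>verts = T, arcs = R\<rparr> G h" and S: "S = h ` T"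
    using assms by (auto simp: simplices_def)
  show "finite S" "S \<noteq> {}" "S \<subseteq> verts G"
    using T h S by (auto simp: digraph_hom_def)
  define below where "below = (\<lambda>t. {s \<in> T. (s, t) \<in> R})"
  define r where "r = (\<lambda>a. real (card (below (inv_into T h a))))"
  have RT: "R \<subseteq> T \<times> T" and rf: "refl_on T R" and tr: "trans R" and as: "antisym R" and tot: "total_on T R"
    using T(3) by (auto simp: order_on_defs)
  have "(a, b) \<in> arcs G" if ab: "a \<in> S" "b \<in> S" "r a \<le> r b" for a b
  proof -
    let ?s = "inv_into T h a" and ?t = "inv_into T h b"
    have st: "?s \<in> T" "?t \<in> T" "h ?s = a" "h ?t = b"
      using ab S by (auto simp: inv_into_into f_inv_into_f)
    have "(?s, ?t) \<in> R"
    proof (rule ccontr)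
      assume n: "(?s, ?t) \<notin> R"
      then have "(?t, ?s) \<in> R" using st rf tot by (metis refl_onD total_on_def)
      then have "below ?t \<subseteq> below ?s" using tr by (auto simp: below_def dest: transD)
      moreover have "?s \<in> below ?s" "?s \<notin> below ?t" using n st rf by (auto simp: below_def refl_onD)
      ultimately have "below ?t \<subset> below ?s" by blast
      then have "card (below ?t) < card (below ?s)"
        using T(1) by (auto intro!: psubset_card_mono simp: below_def)
      then show False using ab(3) by (simp add: r_def)
    qed
    then have "(h ?s, h ?t) \<in> arcs G" using h unfolding digraph_hom_def by simp
    then show ?thesis using st by simp
  qed
  then show "\<exists>r :: 'a \<Rightarrow> real. \<forall>a\<in>S. \<forall>b\<in>S. r a \<le> r b \<longrightarrow> (a, b) \<in> arcs G" by blast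
qed

text \<open>Sorting \<open>S\<close> by \<open>r\<close> yields the total order: its elements are
  the positions in the sorted list.\<close>

lemma ranking_imp_simplices:
  fixes r :: "'a \<Rightarrow> real"
  assumes "finite S" "S \<noteq> {}" "S \<subseteq> verts G"
    and r: "\<And>a b. a \<in> S \<Longrightarrow> b \<in> S \<Longrightarrow> r a \<le> r b \<Longrightarrow> (a, b) \<in> arcs G"
  shows "S \<in> simplices G"
proof -
  obtain xs0 where xs0: "set xs0 = S" using assms(1) finite_list by blast
  define xs where "xs = sort_key r xs0"
  have xs: "set xs = S" "sorted (map r xs)" using xs0 by (auto simp: xs_def)
  let ?T = "{..<length xs}" and ?R = "{(i, j). i \<le> j \<and> j < length xs}"
  have "linear_order_on ?T ?R"
    by (auto simp: order_on_defs refl_on_def trans_def antisym_def total_on_def)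
  moreover have "digraph_hom \<lparr>verts = ?T, arcs = ?R\<rparr> G (\<lambda>i. xs ! i)"
    unfolding digraph_hom_def
  proof (intro conjI allI impI)
    show "(!) xs \<in> verts \<lparr>verts = ?T, arcs = ?R\<rparr> \<rightarrow> verts G" using xs(1) assms(3) by auto
    fix i j assume "(i, j) \<in> arcs \<lparr>verts = ?T, arcs = ?R\<rparr>"
    then have ij: "i \<le> j" "j < length xs" by auto
    then have "r (xs ! i) \<le> r (xs ! j)" using sorted_nth_mono[OF xs(2), of i j] by simp
    then show "(xs ! i, xs ! j) \<in> arcs G" using ij xs(1) by (intro r) auto
  qed
  moreover have "S = (\<lambda>i. xs ! i) ` ?T" using xs(1) by (auto simp: set_conv_nth)
  moreover have "?T \<noteq> {}" using xs(1) assms(2) by auto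
  ultimately show ?thesis unfolding simplices_def by blast
qed

lemma simplices_subset:
  assumes "S \<in> simplices G" "S' \<subseteq> S" "S' \<noteq> {}"
  shows "S' \<in> simplices G"
proof -
  obtain r :: "'a \<Rightarrow> real" where r: "\<forall>a\<in>S. \<forall>b\<in>S. r a \<le> r b \<longrightarrow> (a, b) \<in> arcs G"
    using simplices_imp_ranking(4)[OF assms(1)] by blast
  show ?thesis
    using ranking_imp_simplices[of S' G r] simplices_imp_ranking(1-3)[OF assms(1)] assms(2,3) r
    by (meson finite_subset subset_iff)
qed

lemma simplices_hom_image:
  assumes "digraph_hom G H g" "S \<in> simplices G"
  shows "g ` S \<in> simplices H"
proof -
  obtain T :: "nat set" and R h where T: "finite T" "T \<noteq> {}" "linear_order_on T R"
    and h: "digraph_hom \<lparr>verts = T, arcs = R\<rparr> G h" and S: "S = h ` T"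
    using assms(2) by (auto simp: simplices_def)
  have "digraph_hom \<lparr>verts = T, arcs = R\<rparr> H (g \<circ> h)"
    using assms(1) h by (auto simp: digraph_hom_def)
  moreover have "g ` S = (g \<circ> h) ` T" using S by auto
  ultimately show ?thesis using T unfolding simplices_def by blast
qed

text \<open>A simplex may admit orderings with different first vertices. For fixed \<open>G\<close>
  the choice depends on the set \<open>S\<close> alone, so equal level sets have equal
  sources.\<close>

definition source :: "'a digraph \<Rightarrow> 'a set \<Rightarrow> 'a" where
  "source G S = (SOME a. a \<in> S \<and> (\<forall>b\<in>S. (a, b) \<in> arcs G))"

lemma source_simplex:
  assumes "S \<in> simplices G"
  shows "source G S \<in> S" "b \<in> S \<Longrightarrow> (source G S, b) \<in> arcs G"
proof -
  obtain r :: "'a \<Rightarrow> real" where r: "\<forall>a\<in>S. \<forall>b\<in>S. r a \<le> r b \<longrightarrow> (a, b) \<in> arcs G"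
    using simplices_imp_ranking(4)[OF assms] by blast
  obtain a where "a \<in> S" "\<forall>b\<in>S. r a \<le> r b"
    using ex_min_if_finite[of "r ` S"] simplices_imp_ranking(1,2)[OF assms] by (auto simp: not_less)
  then have "a \<in> S \<and> (\<forall>b\<in>S. (a, b) \<in> arcs G)" using r by blast
  then have "source G S \<in> S \<and> (\<forall>b\<in>S. (source G S, b) \<in> arcs G)"
    unfolding source_def by (rule someI)
  then show "source G S \<in> S" "b \<in> S \<Longrightarrow> (source G S, b) \<in> arcs G" by auto
qed

section \<open>Maps into the realisation and their homotopies\<close>

abbreviation realisation :: "'a digraph \<Rightarrow> ('a \<Rightarrow> real) topology" where
  "realisation G \<equiv> geometric_realisation (verts G) (simplices G)"

lemma topspace_realisation:
  "x \<in> topspace (realisation G) \<longleftrightarrow> x \<in> extensional (verts G) \<and> (\<forall>v\<in>verts G. 0 \<le> x v) \<and>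
     (\<Sum>v\<in>verts G. x v) = 1 \<and> {v \<in> verts G. x v \<noteq> 0} \<in> simplices G"
  by (auto simp: geometric_realisation_def PiE_def)

lemma continuous_map_into_realisation:
  "continuous_map Z (realisation G) w \<longleftrightarrow>
    (\<forall>v\<in>verts G. continuous_map Z euclideanreal (\<lambda>z. w z v)) \<and>
    (\<forall>z\<in>topspace Z. w z \<in> topspace (realisation G))"
  unfolding geometric_realisation_def
  by (auto simp: continuous_map_in_subtopology continuous_map_componentwise Pi_iff PiE_iff)

lemma continuous_map_realisation_coordinate:
  "v \<in> verts G \<Longrightarrow> continuous_map (realisation G) euclideanreal (\<lambda>x. x v)"
  using continuous_map_into_realisation[of "realisation G" G "\<lambda>x. x"] by auto

text \<open>The segment from \<open>u z\<close> to \<open>v z\<close> stays in the closed simplex on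
  \<open>S\<close>, as nonempty subsets of simplices are simplices.\<close>

lemma homotopic_realisation_linear:
  assumes u: "continuous_map Z (realisation G) u" and v: "continuous_map Z (realisation G) v"
    and S: "\<And>z. z \<in> topspace Z \<Longrightarrow> \<exists>S\<in>simplices G. \<forall>w\<in>verts G. u z w \<noteq> 0 \<or> v z w \<noteq> 0 \<longrightarrow> w \<in> S"
  shows "homotopic_with (\<lambda>_. True) Z (realisation G) u v"
proof (rule homotopic_withI)
  let ?I = "prod_topology (top_of_set {0..1::real}) Z"
  let ?h = "\<lambda>y. \<lambda>w\<in>verts G. (1 - fst y) * u (snd y) w + fst y * v (snd y) w"
  have uv: "u z \<in> topspace (realisation G)" "v z \<in> topspace (realisation G)" if "z \<in> topspace Z" for z
    using u v that by (auto simp: continuous_map_def)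
  show "continuous_map ?I (realisation G) ?h"
    unfolding continuous_map_into_realisation
  proof (intro conjI ballI)
    fix w assume w: "w \<in> verts G"
    have cu: "continuous_map ?I euclideanreal (\<lambda>y. u (snd y) w)"
      and cv: "continuous_map ?I euclideanreal (\<lambda>y. v (snd y) w)"
      using continuous_map_of_snd[of "top_of_set {0..1::real}" Z euclideanreal "\<lambda>z. u z w"]
        continuous_map_of_snd[of "top_of_set {0..1::real}" Z euclideanreal "\<lambda>z. v z w"]
        u v w unfolding continuous_map_into_realisation by (auto simp: o_def)
    have ct: "continuous_map ?I euclideanreal fst"
      using continuous_map_fst continuous_map_in_subtopology by blast
    show "continuous_map ?I euclideanreal (\<lambda>y. ?h y w)"
      using w by (simp, intro continuous_intros cu cv ct)
  next
    fix y assume "y \<in> topspace ?I"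
    then obtain t z where y: "y = (t, z)" "0 \<le> t" "t \<le> 1" "z \<in> topspace Z" by auto
    note uz = uv(1)[OF y(4), unfolded topspace_realisation]
    note vz = uv(2)[OF y(4), unfolded topspace_realisation]
    have nn: "?h y w \<ge> 0" if "w \<in> verts G" for w using y that uz vz by simp
    have "(\<Sum>w\<in>verts G. ?h y w) = (1 - t) * (\<Sum>w\<in>verts G. u z w) + t * (\<Sum>w\<in>verts G. v z w)"
      by (simp add: y(1) sum.distrib sum_distrib_left)
    also have "\<dots> = 1" using uz vz by simp
    finally have sum1: "(\<Sum>w\<in>verts G. ?h y w) = 1" .
    obtain S where S: "S \<in> simplices G" "\<forall>w\<in>verts G. u z w \<noteq> 0 \<or> v z w \<noteq> 0 \<longrightarrow> w \<in> S"
      using S[OF y(4)] by blast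
    have "{w \<in> verts G. ?h y w \<noteq> 0} \<in> simplices G"
    proof (rule simplices_subset[OF S(1)])
      show "{w \<in> verts G. ?h y w \<noteq> 0} \<subseteq> S" using S(2) y(1) by auto
      show "{w \<in> verts G. ?h y w \<noteq> 0} \<noteq> {}"
      proof
        assume "{w \<in> verts G. ?h y w \<noteq> 0} = {}"
        then have "(\<Sum>w\<in>verts G. ?h y w) = 0" by (intro sum.neutral) blast
        with sum1 show False by simp
      qed
    qed
    with nn sum1 show "?h y \<in> topspace (realisation G)"
      unfolding topspace_realisation by auto
  qed
  show "?h (0, z) = u z" "?h (1, z) = v z" if "z \<in> topspace Z" for z
    using uv[OF that] by (auto simp: topspace_realisation extensional_def)
qed

text \<open>The distribution of \<open>\<tau> t\<close> for \<open>t\<close> uniform in \<open>[0, 1)\<close>, as barycentric coordinates.\<close>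

definition path_point :: "'a digraph \<Rightarrow> (real \<Rightarrow> 'a) \<Rightarrow> 'a \<Rightarrow> real" where
  "path_point G \<tau> = (\<lambda>v\<in>verts G. measure lborel {t \<in> {0..<1}. \<tau> t = v})"

lemma path_point_support:
  assumes "path_point G \<tau> v \<noteq> 0" "v \<in> verts G"
  shows "\<exists>t\<in>{0..<1}. \<tau> t = v"
proof (rule ccontr)
  assume "\<not> ?thesis"
  then have e: "{t \<in> {0..<1}. \<tau> t = v} = {}" by blast
  have "path_point G \<tau> v = measure lborel {t \<in> {0..<1}. \<tau> t = v}"
    using assms(2) by (simp add: path_point_def)
  with assms(1) show False unfolding e by simp
qed

lemma path_point_cong:
  assumes "\<And>t. t \<in> {0..<1} \<Longrightarrow> \<tau> t = \<tau>' t"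
  shows "path_point G \<tau> = path_point G \<tau>'"
proof -
  have "{t \<in> {0..<1}. \<tau> t = v} = {t \<in> {0..<1}. \<tau>' t = v}" for v
    using assms by auto
  then show ?thesis by (simp only: path_point_def)
qed

text \<open>A vertex of nonzero weight is visited by \<open>\<tau>\<close> at some time. Ranked by
  such times, these vertices form a simplex, because \<open>\<tau>\<close> runs along arcs. The
  thresholds make the level sets measurable, so that the weights add up to the length of the
  interval.\<close>

lemma path_point_in_realisation:
  fixes u :: "'k \<Rightarrow> real"
  assumes V: "finite (verts G)" and "finite I"
    and eq: "\<And>t. t \<in> {0..<1} \<Longrightarrow> \<tau> t = T {k \<in> I. t < u k}"
    and \<tau>: "\<And>t. t \<in> {0..<1} \<Longrightarrow> \<tau> t \<in> verts G"
    and arc: "\<And>s t. 0 \<le> s \<Longrightarrow> s \<le> t \<Longrightarrow> t < 1 \<Longrightarrow> (\<tau> s, \<tau> t) \<in> arcs G"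
  shows "path_point G \<tau> \<in> topspace (realisation G)"
proof -
  have "(\<Sum>v\<in>verts G. path_point G \<tau> v) = (\<Sum>v\<in>verts G. measure lborel {t \<in> {0..<1}. \<tau> t = v})"
    by (simp add: path_point_def)
  also have "\<dots> = measure lborel (\<Union>v\<in>verts G. {t \<in> {0..<1}. \<tau> t = v})"
  proof (rule measure_finite_Union[symmetric, OF V])
    show "(\<lambda>v. {t \<in> {0..<1}. \<tau> t = v}) ` verts G \<subseteq> sets lborel"
      using threshold_level_set_measurable[where \<tau> = \<tau> and T = T and I = I and u = u, OF \<open>finite I\<close> eq] by blast
    show "disjoint_family_on (\<lambda>v. {t \<in> {0..<1}. \<tau> t = v}) (verts G)"
      by (auto simp: disjoint_family_on_def)
    show "emeasure lborel {t \<in> {0..<1}. \<tau> t = v} \<noteq> \<infinity>" for v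
    proof -
      have "emeasure lborel {t \<in> {0..<1}. \<tau> t = v} \<le> emeasure lborel {0..<1::real}"
        by (rule emeasure_mono) auto
      then show ?thesis by (auto simp: top_unique)
    qed
  qed
  also have "(\<Union>v\<in>verts G. {t \<in> {0..<1}. \<tau> t = v}) = {0..<1}" using \<tau> by auto
  finally have sum1: "(\<Sum>v\<in>verts G. path_point G \<tau> v) = 1" by simp
  define S where "S = {v \<in> verts G. path_point G \<tau> v \<noteq> 0}"
  have "\<forall>v\<in>S. \<exists>t\<in>{0..<1}. \<tau> t = v" using path_point_support by (fastforce simp: S_def)
  then obtain r where r: "\<And>v. v \<in> S \<Longrightarrow> r v \<in> {0..<1} \<and> \<tau> (r v) = v" by metis
  have "S \<in> simplices G"
  proof (rule ranking_imp_simplices[of S G r])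
    show "finite S" "S \<subseteq> verts G" using V by (auto simp: S_def)
    show "S \<noteq> {}"
    proof
      assume "S = {}"
      then have "(\<Sum>v\<in>verts G. path_point G \<tau> v) = 0" by (intro sum.neutral) (auto simp: S_def)
      with sum1 show False by simp
    qed
    show "(a, b) \<in> arcs G" if "a \<in> S" "b \<in> S" "r a \<le> r b" for a b
      using arc[of "r a" "r b"] r[OF that(1)] r[OF that(2)] that(3) by auto
  qed
  then show ?thesis
    using sum1 unfolding topspace_realisation S_def by (auto simp: path_point_def)
qed

text \<open>\<open>T\<close> is the same for all \<open>z\<close>: only the thresholds move, and the
  measure of a level set is a sum of interval lengths that depend continuously on them.\<close>

lemma continuous_map_path_point:
  fixes u :: "'z \<Rightarrow> 'k \<Rightarrow> real"
  assumes V: "finite (verts G)" and I: "finite I"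
    and u: "\<And>k. k \<in> I \<Longrightarrow> continuous_map Z euclideanreal (\<lambda>z. u z k)"
    and eq: "\<And>z t. z \<in> topspace Z \<Longrightarrow> t \<in> {0..<1} \<Longrightarrow> \<tau> z t = T {k \<in> I. t < u z k}"
    and \<tau>: "\<And>z t. z \<in> topspace Z \<Longrightarrow> t \<in> {0..<1} \<Longrightarrow> \<tau> z t \<in> verts G"
    and arc: "\<And>z s t. z \<in> topspace Z \<Longrightarrow> 0 \<le> s \<Longrightarrow> s \<le> t \<Longrightarrow> t < 1 \<Longrightarrow> (\<tau> z s, \<tau> z t) \<in> arcs G"
  shows "continuous_map Z (realisation G) (\<lambda>z. path_point G (\<tau> z))"
  unfolding continuous_map_into_realisation
proof (intro conjI ballI)
  fix v assume v: "v \<in> verts G"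
  have "continuous_map Z euclideanreal (\<lambda>z. \<Sum>A | A \<in> Pow I \<and> T A = v.
      max 0 (Min (insert 1 ((\<lambda>k. u z k) ` A)) - Max (insert 0 ((\<lambda>k. u z k) ` (I - A)))))"
    using I finite_subset[OF _ I] by (intro continuous_intros u) auto
  then show "continuous_map Z euclideanreal (\<lambda>z. path_point G (\<tau> z) v)"
  proof (rule continuous_map_eq)
    fix z assume z: "z \<in> topspace Z"
    have "measure lborel {t \<in> {0..<1}. \<tau> z t = v} = (\<Sum>A | A \<in> Pow I \<and> T A = v.
        max 0 (Min (insert 1 ((\<lambda>k. u z k) ` A)) - Max (insert 0 ((\<lambda>k. u z k) ` (I - A)))))"
      by (rule measure_threshold_level_set[OF I]) (rule eq[OF z])
    then show "(\<Sum>A | A \<in> Pow I \<and> T A = v. max 0 (Min (insert 1 ((\<lambda>k. u z k) ` A)) -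
        Max (insert 0 ((\<lambda>k. u z k) ` (I - A))))) = path_point G (\<tau> z) v"
      using v by (simp only: path_point_def restrict_apply if_True)
  qed
next
  show "path_point G (\<tau> z) \<in> topspace (realisation G)" if "z \<in> topspace Z" for z
    by (rule path_point_in_realisation[where u = "u z" and T = T, OF V I eq[OF that] \<tau>[OF that] arc[OF that]])
qed

subsection \<open>Realisation of polymorphisms\<close>

definition height :: "'a digraph \<Rightarrow> ('a \<Rightarrow> real) \<Rightarrow> real" where
  "height G x = Max (insert 0 (x ` verts G))"

text \<open>For a point of the realisation, division by its largest coordinate makes the level sets
  nonempty for all \<open>t < 1\<close>. Thus all points are described over the same
  interval.\<close>

definition level :: "'a digraph \<Rightarrow> ('a \<Rightarrow> real) \<Rightarrow> real \<Rightarrow> 'a set" where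
  "level G x t = {v \<in> verts G. t < x v / height G x}"

definition vertex_point :: "'a digraph \<Rightarrow> 'a \<Rightarrow> 'a \<Rightarrow> real" where
  "vertex_point G v = (\<lambda>w\<in>verts G. if w = v then 1 else 0)"

text \<open>Unlike the linear extension of \<open>g\<close>, this map has \<open>g ` level G x t\<close> as its level sets.\<close>

definition push :: "'a digraph \<Rightarrow> ('a \<Rightarrow> 'a) \<Rightarrow> ('a \<Rightarrow> real) \<Rightarrow> 'a \<Rightarrow> real" where
  "push G g x = (let m = \<lambda>v. Max (insert 0 (x ` {w \<in> verts G. g w = v}))
     in (\<lambda>v\<in>verts G. m v / (\<Sum>u\<in>verts G. m u)))"

text \<open>Moving along the level sets of \<open>x\<close> from large to small, their sources form a chain
  in the digraph, so the following defines points of the realisation.\<close>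

definition hom_map :: "'a digraph \<Rightarrow> ('a \<Rightarrow> 'a) \<Rightarrow> ('a \<Rightarrow> real) \<Rightarrow> 'a \<Rightarrow> real" where
  "hom_map G g x = path_point G (\<lambda>t. g (source G (level G x t)))"

definition poly_map :: "'a digraph \<Rightarrow> nat \<Rightarrow> ((nat \<Rightarrow> 'a) \<Rightarrow> 'a) \<Rightarrow> (nat \<Rightarrow> 'a \<Rightarrow> real) \<Rightarrow> 'a \<Rightarrow> real" where
  "poly_map G p f z = path_point G (\<lambda>t. f (\<lambda>i\<in>{..<p}. source G (level G (z i) t)))"

section \<open>Level sets, their sources and the maps built from them\<close>

locale finite_refl_digraph =
  fixes G :: "'a digraph"
  assumes G: "refl_digraph G"
begin

abbreviation "V \<equiv> verts G"
abbreviation "X \<equiv> realisation G"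

lemma finV: "finite V" and neV: "V \<noteq> {}" and arcsV: "arcs G \<subseteq> V \<times> V"
  and reflV: "v \<in> V \<Longrightarrow> (v, v) \<in> arcs G"
  using G by (auto simp: refl_digraph_def refl_on_def)

lemma singleton_simplex: "v \<in> V \<Longrightarrow> {v} \<in> simplices G"
  by (rule ranking_imp_simplices[of _ _ "\<lambda>_. 0"]) (auto simp: reflV)

lemma source_singleton: "v \<in> V \<Longrightarrow> source G {v} = v"
  using source_simplex(1)[OF singleton_simplex] by simp

lemma height_ge: "v \<in> V \<Longrightarrow> x v \<le> height G x"
  using finV by (auto simp: height_def)

lemma height_pos:
  assumes "x \<in> topspace X" shows "0 < height G x"
proof (rule ccontr)
  assume "\<not> ?thesis"
  then have "x v = 0" if "v \<in> V" for v
    using height_ge[OF that, of x] assms that by (force simp: topspace_realisation)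
  then have "(\<Sum>v\<in>V. x v) = 0" by simp
  then show False using assms by (simp add: topspace_realisation)
qed

lemma height_attained:
  assumes "x \<in> topspace X" shows "\<exists>v\<in>V. x v = height G x"
proof -
  have "height G x \<in> insert 0 (x ` V)"
    unfolding height_def using finV by (intro Max_in) auto
  then show ?thesis using height_pos[OF assms] by auto
qed

lemma continuous_height: "continuous_map X euclideanreal (height G)"
  unfolding height_def
  using continuous_map_Max_insert[OF finV continuous_map_realisation_coordinate, where c = 0]
  by simp

lemma continuous_relative_height:
  assumes "v \<in> V" shows "continuous_map X euclideanreal (\<lambda>x. x v / height G x)"
  by (intro continuous_map_real_divide continuous_map_realisation_coordinate continuous_height)
    (use assms height_pos in force)+

lemma level_subset: "level G x t \<subseteq> V"
  by (auto simp: level_def)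

lemma level_antimono: "s \<le> t \<Longrightarrow> level G x t \<subseteq> level G x s"
  by (auto simp: level_def)

lemma level_nonempty:
  assumes "x \<in> topspace X" "t < 1" shows "level G x t \<noteq> {}"
  using height_attained[OF assms(1)] height_pos[OF assms(1)] assms(2) by (force simp: level_def)

lemma level_subset_support:
  assumes "x \<in> topspace X" "0 \<le> t" shows "level G x t \<subseteq> {v \<in> V. x v \<noteq> 0}"
  using assms(2) by (auto simp: level_def)

lemma level_simplex:
  assumes "x \<in> topspace X" "0 \<le> t" "t < 1" shows "level G x t \<in> simplices G"
  using simplices_subset[OF _ level_subset_support[OF assms(1,2)] level_nonempty[OF assms(1,3)]] assms(1)
  by (simp add: topspace_realisation)

lemma source_level_in:
  assumes "x \<in> topspace X" "0 \<le> t" "t < 1"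
  shows "source G (level G x t) \<in> level G x t" "source G (level G x t) \<in> V"
    "x (source G (level G x t)) \<noteq> 0"
  using source_simplex(1)[OF level_simplex[OF assms]] level_subset level_subset_support[OF assms(1,2)]
  by blast+

lemma source_level_arc:
  assumes "x \<in> topspace X" "0 \<le> s" "s \<le> t" "t < 1"
  shows "(source G (level G x s), source G (level G x t)) \<in> arcs G"
  using source_simplex(2)[OF level_simplex[of x s]] source_level_in(1)[of x t] level_antimono[OF assms(3), of x] assms
  by fastforce

lemma vertex_point_in: "v \<in> V \<Longrightarrow> vertex_point G v \<in> topspace X"
proof -
  assume v: "v \<in> V"
  then have "{w \<in> V. vertex_point G v w \<noteq> 0} = {v}" by (auto simp: vertex_point_def)
  then show ?thesis
    using v singleton_simplex finV by (auto simp: topspace_realisation vertex_point_def)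
qed

lemma level_vertex_point:
  assumes "v \<in> V" "0 \<le> t" "t < 1" shows "level G (vertex_point G v) t = {v}"
  using level_subset_support[OF vertex_point_in[OF assms(1)] assms(2)]
    level_nonempty[OF vertex_point_in[OF assms(1)] assms(3)]
  by (auto simp: vertex_point_def split: if_splits)

text \<open>A superlevel set of the maximum over the fibres of \<open>g\<close> is the image under
  \<open>g\<close> of the superlevel set of \<open>x\<close>. The normalising sum \<open>N\<close>
  rescales coordinates and height alike, so it cancels in relative heights.\<close>

lemma
  assumes g: "digraph_hom G G g" and x: "x \<in> topspace X"
  shows push_in: "push G g x \<in> topspace X"
    and level_push: "0 \<le> t \<Longrightarrow> level G (push G g x) t = g ` level G x t"
proof -
  define m where "m = (\<lambda>v. Max (insert 0 (x ` {w \<in> V. g w = v})))"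
  define N where "N = (\<Sum>u\<in>V. m u)"
  have p: "push G g x = (\<lambda>v\<in>V. m v / N)"
    by (simp add: push_def m_def N_def Let_def)
  have gV: "g w \<in> V" if "w \<in> V" for w using g that by (auto simp: digraph_hom_def)
  have lt_m: "t < m v \<longleftrightarrow> (\<exists>w\<in>V. g w = v \<and> t < x w)" if "0 \<le> t" for t v
    using finV that by (auto simp: m_def Max_gr_iff)
  have m0: "0 \<le> m v" for v using finV by (auto simp: m_def)
  have m_nz: "m v \<noteq> 0 \<longleftrightarrow> (\<exists>w\<in>V. g w = v \<and> x w \<noteq> 0)" for v
  proof -
    have "0 < x w \<longleftrightarrow> x w \<noteq> 0" if "w \<in> V" for w
      using x that by (auto simp: topspace_realisation less_le)
    moreover have "m v \<noteq> 0 \<longleftrightarrow> 0 < m v" using m0[of v] by linarith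
    ultimately show ?thesis using lt_m[of 0 v] by auto
  qed
  obtain w0 where w0: "w0 \<in> V" "x w0 = height G x" using height_attained[OF x] by blast
  have m_le: "m v \<le> height G x" for v
    unfolding m_def height_def using finV by (intro Max_mono) auto
  \<comment> \<open>The fibre through a highest vertex keeps the full height, so \<open>x\<close>
    and \<open>m\<close> have the same maximum.\<close>
  have m_max: "m (g w0) = height G x"
  proof (rule antisym[OF m_le])
    show "height G x \<le> m (g w0)"
      unfolding m_def w0(2)[symmetric] by (rule Max_ge) (use finV w0(1) in auto)
  qed
  have N: "N > 0"
    unfolding N_def using gV[OF w0(1)] finV m0 m_max height_pos[OF x] by (intro sum_pos2[of _ "g w0"]) auto
  have "{v \<in> V. push G g x v \<noteq> 0} = g ` {w \<in> V. x w \<noteq> 0}"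
    using N gV m_nz by (auto simp: p)
  then have "{v \<in> V. push G g x v \<noteq> 0} \<in> simplices G"
    using simplices_hom_image[OF g] x by (simp add: topspace_realisation)
  moreover have "(\<Sum>v\<in>V. push G g x v) = 1"
    using N by (simp add: p N_def flip: sum_divide_distrib)
  ultimately show "push G g x \<in> topspace X"
    using m0 N by (auto simp: topspace_realisation p)
  have h: "height G (push G g x) = height G x / N"
    unfolding height_def[of G "push G g x"]
  proof (rule Max_eqI)
    show "height G x / N \<in> insert 0 (push G g x ` V)"
    proof -
      have "push G g x (g w0) = height G x / N" using m_max gV[OF w0(1)] by (simp add: p)
      then show ?thesis using gV[OF w0(1)] by (metis imageI insertI2)
    qed
    show "y \<le> height G x / N" if "y \<in> insert 0 (push G g x ` V)" for y
      using that N m_le height_pos[OF x] by (auto simp: p intro: divide_right_mono)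
  qed (use finV in auto)
  show "level G (push G g x) t = g ` level G x t" if "0 \<le> t"
  proof -
    have "t < push G g x v / height G (push G g x) \<longleftrightarrow> (\<exists>w\<in>V. g w = v \<and> t < x w / height G x)"
      if "v \<in> V" for v
    proof -
      have "push G g x v / height G (push G g x) = m v / height G x"
        unfolding h using that N by (simp add: p)
      then show ?thesis
        using lt_m[of "t * height G x" v] height_pos[OF x] \<open>0 \<le> t\<close> by (simp add: pos_less_divide_eq)
    qed
    then show ?thesis using gV by (auto simp: level_def)
  qed
qed

lemma continuous_push:
  assumes g: "digraph_hom G G g"
  shows "continuous_map X X (push G g)"
  unfolding continuous_map_into_realisation
proof (intro conjI ballI)
  fix v assume v: "v \<in> V"
  define m where "m = (\<lambda>(x :: 'a \<Rightarrow> real) v. Max (insert 0 ((\<lambda>w. x w) ` {w \<in> V. g w = v})))"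
  have m: "continuous_map X euclideanreal (\<lambda>x. m x v)" for v
    unfolding m_def by (intro continuous_intros continuous_map_realisation_coordinate) (use finV in auto)
  \<comment> \<open>As division by zero gives 0, a vanishing denominator would make all coordinates
    of \<open>push G g x\<close> vanish.\<close>
  have "(\<Sum>u\<in>V. m x u) \<noteq> 0" if "x \<in> topspace X" for x
  proof
    assume "(\<Sum>u\<in>V. m x u) = 0"
    then have "push G g x = (\<lambda>v\<in>V. 0)" by (auto simp: push_def m_def)
    then show False using push_in[OF g that] by (simp add: topspace_realisation)
  qed
  then have "continuous_map X euclideanreal (\<lambda>x. m x v / (\<Sum>u\<in>V. m x u))"
    by (intro continuous_intros m) (use finV in auto)
  then show "continuous_map X euclideanreal (\<lambda>x. push G g x v)"
    using v by (simp add: push_def m_def Let_def)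
qed (rule push_in[OF g])

lemma push_vertex_point:
  assumes g: "digraph_hom G G g" and v: "v \<in> V"
  shows "push G g (vertex_point G v) = vertex_point G (g v)"
proof
  fix u
  have gv: "g v \<in> V" using g v by (auto simp: digraph_hom_def)
  have in1: "push G g (vertex_point G v) \<in> topspace X" by (rule push_in[OF g vertex_point_in[OF v]])
  then have nn: "\<And>w. w \<in> V \<Longrightarrow> 0 \<le> push G g (vertex_point G v) w"
    and s1: "(\<Sum>w\<in>V. push G g (vertex_point G v) w) = 1"
    by (auto simp: topspace_realisation)
  have "level G (push G g (vertex_point G v)) 0 = {g v}"
    using level_push[OF g vertex_point_in[OF v]] level_vertex_point[OF v] by simp
  then have z: "push G g (vertex_point G v) w = 0" if "w \<in> V" "w \<noteq> g v" for w
    using nn[OF that(1)] that height_pos[OF in1] by (force simp: level_def zero_less_divide_iff)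
  have "(\<Sum>w\<in>V. push G g (vertex_point G v) w) = push G g (vertex_point G v) (g v)"
    using finV gv z by (subst sum.remove[of _ "g v"]) auto
  then show "push G g (vertex_point G v) u = vertex_point G (g v) u"
    using s1 z gv in1 by (auto simp: vertex_point_def topspace_realisation extensional_def)
qed

lemma continuous_hom_map:
  assumes g: "digraph_hom G G g"
  shows "continuous_map X X (hom_map G g)"
  unfolding hom_map_def
proof (rule continuous_map_path_point[OF finV finV continuous_relative_height, where T = "\<lambda>A. g (source G A)"])
  fix x t assume x: "x \<in> topspace X" and t: "t \<in> {0..<1::real}"
  show "g (source G (level G x t)) = g (source G {k \<in> V. t < x k / height G x})"
    by (simp add: level_def)
  show "g (source G (level G x t)) \<in> V"
    using source_level_in(2)[OF x, of t] t g by (auto simp: digraph_hom_def)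
next
  fix x s t assume "x \<in> topspace X" "0 \<le> s" "s \<le> t" "t < (1::real)"
  then show "(g (source G (level G x s)), g (source G (level G x t))) \<in> arcs G"
    using source_level_arc g by (simp add: digraph_hom_def)
qed

lemma hom_map_support:
  assumes "x \<in> topspace X" "v \<in> V" "hom_map G g x v \<noteq> 0"
  shows "\<exists>w\<in>V. x w \<noteq> 0 \<and> v = g w"
proof -
  obtain t where "t \<in> {0..<1}" "g (source G (level G x t)) = v"
    using path_point_support[OF assms(3)[unfolded hom_map_def] assms(2)] by blast
  then show ?thesis using source_level_in[OF assms(1), of t] by auto
qed

lemma poly_hom:
  assumes f: "polymorphism G p f"
  shows "\<And>x. (\<And>i. i < p \<Longrightarrow> x i \<in> V) \<Longrightarrow> f (\<lambda>i\<in>{..<p}. x i) \<in> V"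
    and "\<And>x y. (\<And>i. i < p \<Longrightarrow> (x i, y i) \<in> arcs G) \<Longrightarrow>
      (f (\<lambda>i\<in>{..<p}. x i), f (\<lambda>i\<in>{..<p}. y i)) \<in> arcs G"
proof -
  show "f (\<lambda>i\<in>{..<p}. x i) \<in> V" if "\<And>i. i < p \<Longrightarrow> x i \<in> V" for x
    using f that unfolding polymorphism_def digraph_hom_def digraph_power_def
    by (auto simp: Pi_iff)
  show "(f (\<lambda>i\<in>{..<p}. x i), f (\<lambda>i\<in>{..<p}. y i)) \<in> arcs G"
    if a: "\<And>i. i < p \<Longrightarrow> (x i, y i) \<in> arcs G" for x y
  proof -
    have "x i \<in> V" "y i \<in> V" if "i < p" for i using a[OF that] arcsV by auto
    then have "((\<lambda>i\<in>{..<p}. x i), (\<lambda>i\<in>{..<p}. y i)) \<in> arcs (digraph_power G p)"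
      using a by (auto simp: digraph_power_def)
    then show ?thesis using f unfolding polymorphism_def digraph_hom_def by blast
  qed
qed

text \<open>The \<open>p\<close> points are encoded by one family of thresholds indexed by pairs
  \<open>(i, v)\<close>. At each \<open>t\<close> its threshold set determines the level sets of all
  the points together.\<close>

lemma continuous_poly_map:
  assumes f: "polymorphism G p f"
  shows "continuous_map (product_topology (\<lambda>_. X) {..<p}) X (poly_map G p f)"
  unfolding poly_map_def
proof (rule continuous_map_path_point[OF finV, where I = "{..<p} \<times> V" and
      u = "\<lambda>z (i, v). z i v / height G (z i)" and
      T = "\<lambda>A. f (\<lambda>i\<in>{..<p}. source G {v. (i, v) \<in> A})"])
  let ?Z = "product_topology (\<lambda>_. X) {..<p}"
  show "finite ({..<p} \<times> V)" using finV by simp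
  show "continuous_map ?Z euclideanreal (\<lambda>z. case k of (i, v) \<Rightarrow> z i v / height G (z i))"
    if kI: "k \<in> {..<p} \<times> V" for k
  proof -
    obtain i v where k: "k = (i, v)" "i \<in> {..<p}" "v \<in> V" using kI by blast
    then show ?thesis
      using continuous_map_compose[OF continuous_map_product_projection[OF k(2), of "\<lambda>_. X"]
          continuous_relative_height[OF k(3)]]
      by (simp add: o_def)
  qed
  fix z assume z: "z \<in> topspace ?Z"
  then have zi: "z i \<in> topspace X" if "i < p" for i
    using that by (auto simp: PiE_iff)
  {
    fix t assume t: "t \<in> {0..<1::real}"
    show "f (\<lambda>i\<in>{..<p}. source G (level G (z i) t)) =
      f (\<lambda>i\<in>{..<p}. source G {v. (i, v) \<in> {k \<in> {..<p} \<times> V. t < (case k of (i, v) \<Rightarrow> z i v / height G (z i))}})"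
      by (auto intro!: arg_cong[of _ _ f] arg_cong[of _ _ "source G"] simp: level_def)
    show "f (\<lambda>i\<in>{..<p}. source G (level G (z i) t)) \<in> V"
      by (rule poly_hom(1)[OF f]) (use source_level_in(2)[OF zi] t in auto)
  next
    fix s t assume "0 \<le> s" "s \<le> t" "t < (1::real)"
    then show "(f (\<lambda>i\<in>{..<p}. source G (level G (z i) s)), f (\<lambda>i\<in>{..<p}. source G (level G (z i) t))) \<in> arcs G"
      using source_level_arc[OF zi] by (intro poly_hom(2)[OF f]) auto
  }
qed

definition axis :: "nat \<Rightarrow> ((nat \<Rightarrow> 'a) \<Rightarrow> 'a) \<Rightarrow> nat \<Rightarrow> (nat \<Rightarrow> 'a) \<Rightarrow> 'a \<Rightarrow> 'a" where
  "axis p f i y a = f (\<lambda>j\<in>{..<p}. if j = i then a else y j)"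

lemma axis_hom:
  assumes f: "polymorphism G p f" and y: "y \<in> {..<p} \<rightarrow> V"
  shows "digraph_hom G G (axis p f i y)"
  unfolding digraph_hom_def axis_def
proof (intro conjI allI impI funcsetI)
  fix a assume "a \<in> V"
  then show "f (\<lambda>j\<in>{..<p}. if j = i then a else y j) \<in> V"
    using y by (intro poly_hom(1)[OF f]) auto
next
  fix a b assume "(a, b) \<in> arcs G"
  then show "(f (\<lambda>j\<in>{..<p}. if j = i then a else y j), f (\<lambda>j\<in>{..<p}. if j = i then b else y j)) \<in> arcs G"
    using y by (intro poly_hom(2)[OF f]) (auto simp: reflV Pi_iff)
qed

text \<open>A vertex point has the same one-element level set at all times, so the sources in the
  fixed coordinates do not change with \<open>t\<close>.\<close>

lemma poly_map_axis:
  assumes y: "y \<in> {..<p} \<rightarrow> V"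
  shows "poly_map G p f (\<lambda>j\<in>{..<p}. if j = i then x else vertex_point G (y j)) = hom_map G (axis p f i y) x"
  unfolding poly_map_def hom_map_def axis_def
proof (rule path_point_cong)
  fix t assume t: "t \<in> {0..<1::real}"
  have "source G (level G (vertex_point G (y j)) t) = y j" if "j < p" for j
  proof -
    have "y j \<in> V" using y that by auto
    then show ?thesis using t by (simp add: level_vertex_point source_singleton)
  qed
  then show "f (\<lambda>j\<in>{..<p}. source G (level G ((\<lambda>j\<in>{..<p}. if j = i then x else vertex_point G (y j)) j) t)) =
     f (\<lambda>j\<in>{..<p}. if j = i then source G (level G x t) else y j)"
    by (intro arg_cong[of _ _ f]) auto
qed

text \<open>All vertices with nonzero weight in a value of \<open>hom_map G g\<close> lie in the
  image of \<open>g\<close>. This turns a vertex missed by \<open>g\<close> into a missed point of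
  the realisation.\<close>

lemma hom_map_misses:
  assumes "v \<in> V" "v \<notin> g ` V" "x \<in> topspace X"
  shows "hom_map G g x \<noteq> vertex_point G v"
proof
  assume "hom_map G g x = vertex_point G v"
  then have "hom_map G g x v \<noteq> 0" using assms(1) by (simp add: vertex_point_def)
  then show False using hom_map_support[OF assms(3,1)] assms(2) by blast
qed

section \<open>Automorphisms and the maps they induce\<close>

text \<open>An injective self-map of the finite set of arcs is onto, so every arc is the image of an
  arc.\<close>

lemma bijective_hom_inverse:
  assumes g: "digraph_hom G G g" and surj: "g ` V = V"
  shows "inj_on g V" "digraph_hom G G (inv_into V g)"
proof -
  show inj: "inj_on g V" using finV surj by (simp add: eq_card_imp_inj_on)
  let ?gg = "map_prod g g"
  have "?gg ` arcs G \<subseteq> arcs G" using g by (auto simp: digraph_hom_def)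
  moreover have "inj_on ?gg (arcs G)"
    by (rule inj_on_subset[OF map_prod_inj_on[OF inj inj] arcsV])
  moreover have "finite (arcs G)" using arcsV finV by (meson finite_SigmaI finite_subset)
  ultimately have arcs: "?gg ` arcs G = arcs G" by (intro endo_inj_surj)
  show "digraph_hom G G (inv_into V g)"
    unfolding digraph_hom_def
  proof (intro conjI allI impI funcsetI)
    show "inv_into V g a \<in> V" if "a \<in> V" for a using that surj by (simp add: inv_into_into)
    fix a b assume "(a, b) \<in> arcs G"
    then have "(a, b) \<in> ?gg ` arcs G" using arcs by simp
    then obtain c d where cd: "(c, d) \<in> arcs G" "a = g c" "b = g d" by auto
    moreover have "c \<in> V" "d \<in> V" using cd(1) arcsV by auto
    ultimately show "(inv_into V g a, inv_into V g b) \<in> arcs G" using inj by simp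
  qed
qed

lemma continuous_relabel:
  assumes g: "digraph_hom G G g" and inj: "inj_on g V" and surj: "g ` V = V"
  shows "continuous_map X X (\<lambda>x. \<lambda>v\<in>V. x (inv_into V g v))"
  unfolding continuous_map_into_realisation
proof (intro conjI ballI)
  fix v assume "v \<in> V"
  then show "continuous_map X euclideanreal (\<lambda>x. (\<lambda>v\<in>V. x (inv_into V g v)) v)"
    using surj by (simp add: continuous_map_realisation_coordinate inv_into_into)
next
  fix x assume x: "x \<in> topspace X"
  have iV: "inv_into V g v \<in> V" if "v \<in> V" for v using that surj by (simp add: inv_into_into)
  have gV: "g v \<in> V" if "v \<in> V" for v using that surj by blast
  have "bij_betw (inv_into V g) V V"
    using bij_betw_inv_into[of g V V] inj surj by (simp add: bij_betw_def)
  then have "(\<Sum>v\<in>V. x (inv_into V g v)) = (\<Sum>v\<in>V. x v)"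
    by (rule sum.reindex_bij_betw)
  moreover have "{v \<in> V. (\<lambda>v\<in>V. x (inv_into V g v)) v \<noteq> 0} = g ` {v \<in> V. x v \<noteq> 0}"
  proof (intro equalityI subsetI)
    fix v assume v: "v \<in> {v \<in> V. (\<lambda>v\<in>V. x (inv_into V g v)) v \<noteq> 0}"
    then have "v = g (inv_into V g v)" using surj by (simp add: f_inv_into_f)
    then show "v \<in> g ` {v \<in> V. x v \<noteq> 0}" using v iV by auto
  qed (use inj gV in auto)
  ultimately show "(\<lambda>v\<in>V. x (inv_into V g v)) \<in> topspace X"
    using x iV simplices_hom_image[OF g] by (auto simp: topspace_realisation)
qed

text \<open>Both values at \<open>x\<close> are supported on the image of the support of
  \<open>x\<close>, which is a simplex.\<close>

lemma homotopic_hom_map_relabel: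
  assumes g: "digraph_hom G G g" and inj: "inj_on g V" and surj: "g ` V = V"
  shows "homotopic_with (\<lambda>_. True) X X (hom_map G g) (\<lambda>x. \<lambda>v\<in>V. x (inv_into V g v))"
proof (rule homotopic_realisation_linear[OF continuous_hom_map[OF g] continuous_relabel[OF assms]])
  fix x assume x: "x \<in> topspace X"
  let ?S = "g ` {w \<in> V. x w \<noteq> 0}"
  have "?S \<in> simplices G" using simplices_hom_image[OF g] x by (simp add: topspace_realisation)
  moreover have "w \<in> ?S" if "w \<in> V" "hom_map G g x w \<noteq> 0" for w
    using hom_map_support[OF x that] by auto
  moreover have "w \<in> ?S" if "w \<in> V" "x (inv_into V g w) \<noteq> 0" for w
  proof -
    have "w = g (inv_into V g w)" "inv_into V g w \<in> V"
      using that(1) surj by (simp_all add: f_inv_into_f inv_into_into)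
    then show ?thesis using that(2) by blast
  qed
  ultimately show "\<exists>S\<in>simplices G. \<forall>w\<in>V. hom_map G g x w \<noteq> 0 \<or> (\<lambda>v\<in>V. x (inv_into V g v)) w \<noteq> 0 \<longrightarrow> w \<in> S"
    by (intro bexI[of _ ?S]) auto
qed

text \<open>The map of an automorphism is homotopic to a permutation of the barycentric coordinates.
  Composing a nullhomotopy of the latter with the inverse permutation contracts the
  identity.\<close>

lemma contractible_if_bijective_hom_map_null:
  assumes g: "digraph_hom G G g" and surj: "g ` V = V"
    and null: "homotopic_with (\<lambda>_. True) X X (hom_map G g) (\<lambda>_. c)"
  shows "contractible_space X"
proof -
  note inj = bijective_hom_inverse(1)[OF g surj] and inv = bijective_hom_inverse(2)[OF g surj]
  let ?r = "\<lambda>g x. \<lambda>v\<in>V. x (inv_into V g v)"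
  let ?g' = "inv_into V g"
  have inj': "inj_on ?g' V" using inj_on_inv_into surj by (metis order_refl)
  have surj': "?g' ` V = V" using inj surj by (metis inv_into_image_cancel order_refl)
  have "homotopic_with (\<lambda>_. True) X X (?r g) (\<lambda>_. c)"
    by (rule homotopic_with_trans[OF homotopic_with_symD[OF homotopic_hom_map_relabel[OF g inj surj]] null])
  then have "homotopic_with (\<lambda>_. True) X X (?r ?g' \<circ> ?r g) (?r ?g' \<circ> (\<lambda>_. c))"
    by (rule homotopic_with_compose_continuous_map_left[OF _ continuous_relabel[OF inv inj' surj']]) simp
  then have "homotopic_with (\<lambda>_. True) X X id (\<lambda>_. ?r ?g' c)"
  proof (rule homotopic_with_eq)
    fix x assume x: "x \<in> topspace X"
    show "id x = (?r ?g' \<circ> ?r g) x"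
    proof
      fix v
      show "id x v = (?r ?g' \<circ> ?r g) x v"
      proof (cases "v \<in> V")
        case True
        have w: "inv_into V ?g' v \<in> V" using True surj' by (simp add: inv_into_into)
        have "?g' (inv_into V ?g' v) = v" using True surj' by (simp add: f_inv_into_f)
        then show ?thesis using True w by simp
      next
        case False
        then show ?thesis using x by (simp add: topspace_realisation extensional_def)
      qed
    qed
  qed auto
  then show ?thesis unfolding contractible_space_def by blast
qed

text \<open>The homotopy at time \<open>s\<close> takes the sources after applying the homomorphisms if
  \<open>t < s\<close>, and before otherwise; sources of images precede images of sources, so these are chains.\<close>

lemma homotopic_poly_map_push:
  assumes f: "polymorphism G p f" and e: "\<And>i. i < p \<Longrightarrow> digraph_hom G G (e i)"
  shows "homotopic_with (\<lambda>_. True) X X (hom_map G (\<lambda>v. f (\<lambda>i\<in>{..<p}. e i v)))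
           (\<lambda>x. poly_map G p f (\<lambda>i\<in>{..<p}. push G (e i) x))"
proof (rule homotopic_withI)
  let ?Z = "prod_topology (top_of_set {0..1::real}) X"
  define c where "c = (\<lambda>S. f (\<lambda>i\<in>{..<p}. source G (e i ` S)))"
  define d where "d = (\<lambda>S. f (\<lambda>i\<in>{..<p}. e i (source G S)))"
  define \<tau> where "\<tau> = (\<lambda>(s, x) t. if t < s then c (level G x t) else d (level G x t))"
  have cd: "c S \<in> V" "d S \<in> V" if S: "S \<in> simplices G" for S
    unfolding c_def d_def
    using source_simplex(1)[OF simplices_hom_image[OF e S]] source_simplex(1)[OF S]
      simplices_imp_ranking(3)[OF S] simplices_imp_ranking(3)[OF simplices_hom_image[OF e S]] e
    by (auto intro!: poly_hom(1)[OF f] simp: digraph_hom_def) blast+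
  \<comment> \<open>As \<open>t\<close> grows, \<open>\<tau>\<close> changes from \<open>c\<close>
    to \<open>d\<close> at most once, so these three kinds of arcs cover all pairs of times. For the
    mixed kind, the source of the image of \<open>S\<close> has an arc to the image of every vertex
    of \<open>S'\<close>.\<close>
  have arcs: "(c S, c S') \<in> arcs G" "(c S, d S') \<in> arcs G" "(d S, d S') \<in> arcs G"
    if S: "S \<in> simplices G" "S' \<in> simplices G" "S' \<subseteq> S" for S S'
  proof -
    have "(source G (e i ` S), b) \<in> arcs G" if "i < p" "b \<in> e i ` S'" for i b
      using source_simplex(2)[OF simplices_hom_image[OF e[OF that(1)] S(1)], of b] that(2) S(3) by blast
    moreover have "source G (e i ` S') \<in> e i ` S'" if "i < p" for i
      using source_simplex(1)[OF simplices_hom_image[OF e[OF that] S(2)]] .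
    moreover have s: "source G S' \<in> S'" using source_simplex(1)[OF S(2)] .
    moreover have "(source G S, source G S') \<in> arcs G" using source_simplex(2)[OF S(1)] s S(3) by blast
    ultimately show "(c S, c S') \<in> arcs G" "(c S, d S') \<in> arcs G" "(d S, d S') \<in> arcs G"
      unfolding c_def d_def using e by (auto intro!: poly_hom(2)[OF f] simp: digraph_hom_def)
  qed
  have lv: "level G x t \<in> simplices G" if "x \<in> topspace X" "0 \<le> t" "t < 1" for x t
    using that by (rule level_simplex)
  show "continuous_map ?Z X (\<lambda>y. path_point G (\<tau> y))"
  \<comment> \<open>The extra index \<open>None\<close> carries the homotopy time \<open>s\<close>,
    which turns \<open>t < s\<close> into one of the threshold conditions.\<close>
  proof (rule continuous_map_path_point[OF finV, where I = "insert None (Some ` V)" and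
      u = "\<lambda>(s, x) k. case k of None \<Rightarrow> s | Some v \<Rightarrow> x v / height G x" and
      T = "\<lambda>A. if None \<in> A then c {v. Some v \<in> A} else d {v. Some v \<in> A}"])
    show "finite (insert None (Some ` V))" using finV by simp
    show "continuous_map ?Z euclideanreal
        (\<lambda>z. (case z of (s, x) \<Rightarrow> \<lambda>k. (case k of None \<Rightarrow> s | Some v \<Rightarrow> x v / height G x)) k)"
      if k: "k \<in> insert None (Some ` V)" for k
    proof (cases k)
      case None
      have "continuous_map ?Z euclideanreal fst"
        using continuous_map_fst continuous_map_in_subtopology by blast
      then show ?thesis by (simp add: None case_prod_unfold)
    next
      case (Some v)
      then have "v \<in> V" using k by auto
      then show ?thesis
        using continuous_map_compose[OF continuous_map_snd continuous_relative_height]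
        by (simp add: Some case_prod_unfold o_def)
    qed
    fix y t assume y: "y \<in> topspace ?Z" and t: "t \<in> {0..<1::real}"
    let ?A = "{k \<in> insert None (Some ` V). t < (case y of (s, x) \<Rightarrow>
         \<lambda>k. (case k of None \<Rightarrow> s | Some v \<Rightarrow> x v / height G x)) k}"
    obtain s x where sx: "y = (s, x)" "x \<in> topspace X" using y by auto
    have "{v. Some v \<in> {k \<in> insert None (Some ` V). t < (case k of None \<Rightarrow> s | Some v \<Rightarrow> x v / height G x)}} = level G x t"
      by (auto simp: level_def)
    then show "\<tau> y t = (if None \<in> ?A then c {v. Some v \<in> ?A} else d {v. Some v \<in> ?A})"
      by (simp add: \<tau>_def sx)
    show "\<tau> y t \<in> V"
      using cd[OF lv[OF sx(2)]] t by (simp add: \<tau>_def sx(1))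
  next
    fix y s' t assume y: "y \<in> topspace ?Z" and t: "0 \<le> s'" "s' \<le> t" "t < (1::real)"
    obtain s x where sx: "y = (s, x)" "x \<in> topspace X" using y by auto
    show "(\<tau> y s', \<tau> y t) \<in> arcs G"
      using arcs[OF lv[OF sx(2)] lv[OF sx(2)] level_antimono] t by (simp add: \<tau>_def sx(1))
  qed
  show "path_point G (\<tau> (0, x)) = hom_map G (\<lambda>v. f (\<lambda>i\<in>{..<p}. e i v)) x" for x
    unfolding hom_map_def by (rule path_point_cong) (simp add: \<tau>_def d_def)
  show "path_point G (\<tau> (1, x)) = poly_map G p f (\<lambda>i\<in>{..<p}. push G (e i) x)" if "x \<in> topspace X" for x
    unfolding poly_map_def
  proof (rule path_point_cong)
    fix t assume t: "t \<in> {0..<1::real}"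
    have "(\<lambda>i\<in>{..<p}. source G (level G ((\<lambda>i\<in>{..<p}. push G (e i) x) i) t)) = (\<lambda>i\<in>{..<p}. source G (e i ` level G x t))"
      using level_push[OF e that] t by auto
    then show "\<tau> (1, x) t = f (\<lambda>i\<in>{..<p}. source G (level G ((\<lambda>i\<in>{..<p}. push G (e i) x) i) t))"
      using t by (simp add: \<tau>_def c_def)
  qed
qed

end

subsection \<open>Polymorphisms of digraphs that triangulate a sphere\<close>

locale sphere_digraph = finite_refl_digraph G + topological_sphere "realisation G" n
  for G :: "'a digraph" and n :: nat
begin

text \<open>Otherwise every direction has an axis that misses a vertex, and then all axes do. Hence
  \<open>poly_map\<close> composed with the maps \<open>push G (e i)\<close> is nullhomotopic,
  although it is homotopic to the map of an automorphism of a noncontractible space.\<close>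

lemma exists_surjective_axis:
  assumes f: "polymorphism G p f" and e: "\<And>i. i < p \<Longrightarrow> digraph_hom G G (e i)"
    and surj: "(\<lambda>v. f (\<lambda>i\<in>{..<p}. e i v)) ` V = V"
  shows "\<exists>i<p. \<forall>y\<in>{..<p} \<rightarrow> V. axis p f i y ` V = V"
proof (rule ccontr)
  assume neg: "\<not> ?thesis"
  note F = continuous_poly_map[OF f]
  obtain v0 where v0: "v0 \<in> V" using neV by blast
  let ?c = "vertex_point G v0"
  have c: "?c \<in> topspace X" by (rule vertex_point_in[OF v0])
  have sub: "axis p f i y ` V \<subseteq> V" if "y \<in> {..<p} \<rightarrow> V" for i y
    using axis_hom[OF f that, of i] by (auto simp: digraph_hom_def)
  \<comment> \<open>The fixed values can be moved from the vertices \<open>y\<close> to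
    \<open>y0\<close> along paths in the sphere. The map of the axis at \<open>y0\<close> misses a
    point, so if the axis at \<open>y\<close> were onto, its map would be the nullhomotopic map of
    an automorphism.\<close>
  have not_onto: "axis p f i y ` V \<noteq> V" if i: "i < p" and y: "y \<in> {..<p} \<rightarrow> V" for i y
  proof
    assume onto: "axis p f i y ` V = V"
    obtain y0 where y0: "y0 \<in> {..<p} \<rightarrow> V" "axis p f i y0 ` V \<noteq> V" using neg i by blast
    then obtain v where v: "v \<in> V" "v \<notin> axis p f i y0 ` V" using sub by blast
    have vp: "vertex_point G (y j) \<in> topspace X" "vertex_point G (y0 j) \<in> topspace X" if "j < p" for j
      using that y y0 vertex_point_in by auto
    have "homotopic_with (\<lambda>_. True) X X
       (\<lambda>x. poly_map G p f (\<lambda>j\<in>{..<p}. if j = i then x else vertex_point G (y j)))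
       (\<lambda>x. poly_map G p f (\<lambda>j\<in>{..<p}. if j = i then x else vertex_point G (y0 j)))"
    proof (rule homotopic_with_family_compose[OF F])
      fix j assume "j \<in> {..<p}"
      then have j: "j < p" by simp
      show "homotopic_with (\<lambda>_. True) X X (\<lambda>x. if j = i then x else vertex_point G (y j))
          (\<lambda>x. if j = i then x else vertex_point G (y0 j))"
        using homotopic_consts[OF vp(1)[OF j] vp(2)[OF j], of X] by (cases "j = i") simp_all
    qed
    then have "homotopic_with (\<lambda>_. True) X X (hom_map G (axis p f i y)) (hom_map G (axis p f i y0))"
      unfolding poly_map_axis[OF y] poly_map_axis[OF y0(1)] .
    moreover have "homotopic_with (\<lambda>_. True) X X (hom_map G (axis p f i y0)) (\<lambda>_. ?c)"
      by (rule nullhomotopic_missing_point[OF continuous_hom_map[OF axis_hom[OF f y0(1)]] vertex_point_in[OF v(1)] _ c])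
        (rule hom_map_misses[OF v])
    ultimately have "homotopic_with (\<lambda>_. True) X X (hom_map G (axis p f i y)) (\<lambda>_. ?c)"
      by (rule homotopic_with_trans)
    then show False
      using contractible_if_bijective_hom_map_null[OF axis_hom[OF f y] onto] not_contractible by blast
  qed
  have "homotopic_with (\<lambda>_. True) X X (\<lambda>x. poly_map G p f (\<lambda>j\<in>{..<p}. push G (e j) x))
     (\<lambda>x. poly_map G p f (\<lambda>j\<in>{..<p}. ?c))"
  \<comment> \<open>The base points are the vertex points: \<open>push\<close> preserves this set,
    and on axes through them \<open>poly_map\<close> is the \<open>hom_map\<close> of an axis
    homomorphism.\<close>
  proof (rule nullhomotopic_if_all_axes_miss[OF F _ c, where V = "vertex_point G ` V"])
    show "continuous_map X X (push G (e j))" if "j < p" for j by (rule continuous_push[OF e[OF that]])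
    show "vertex_point G ` V \<subseteq> topspace X" using vertex_point_in by blast
    show "?c \<in> vertex_point G ` V" using v0 by blast
    show "push G (e j) ?c \<in> vertex_point G ` V" if "j < p" for j
      using push_vertex_point[OF e[OF that] v0] e[OF that] v0 by (auto simp: digraph_hom_def)
    fix i y assume i: "i < p" and "y \<in> {..<p} \<rightarrow> vertex_point G ` V"
    then have "\<forall>j\<in>{..<p}. \<exists>v\<in>V. y j = vertex_point G v" by blast
    then obtain w where w: "\<And>j. j \<in> {..<p} \<Longrightarrow> w j \<in> V \<and> y j = vertex_point G (w j)" by metis
    then have wV: "w \<in> {..<p} \<rightarrow> V" by blast
    then obtain v where v: "v \<in> V" "v \<notin> axis p f i w ` V" using not_onto[OF i wV] sub by blast
    have "poly_map G p f (\<lambda>j\<in>{..<p}. if j = i then x else y j) \<noteq> vertex_point G v" if "x \<in> topspace X" for x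
    proof -
      have "(\<lambda>j\<in>{..<p}. if j = i then x else y j) = (\<lambda>j\<in>{..<p}. if j = i then x else vertex_point G (w j))"
        using w by auto
      then show ?thesis using poly_map_axis[OF wV, of f i x] hom_map_misses[OF v that] by simp
    qed
    then show "\<exists>q\<in>topspace X. \<forall>x\<in>topspace X. poly_map G p f (\<lambda>j\<in>{..<p}. if j = i then x else y j) \<noteq> q"
      using vertex_point_in[OF v(1)] by blast
  qed
  with homotopic_poly_map_push[OF f e]
  have "homotopic_with (\<lambda>_. True) X X (hom_map G (\<lambda>v. f (\<lambda>i\<in>{..<p}. e i v)))
      (\<lambda>x. poly_map G p f (\<lambda>j\<in>{..<p}. ?c))"
    by (rule homotopic_with_trans)
  moreover have "digraph_hom G G (\<lambda>v. f (\<lambda>i\<in>{..<p}. e i v))"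
    using e unfolding digraph_hom_def
    by (intro conjI funcsetI allI impI poly_hom(1)[OF f] poly_hom(2)[OF f]) (auto simp: Pi_iff)
  ultimately show False
    using contractible_if_bijective_hom_map_null[OF _ surj] not_contractible by blast
qed

text \<open>If \<open>k x\<^sub>0 = z \<noteq> x\<^sub>0\<close> then \<open>x\<^sub>0\<close> and \<open>z\<close> have the same neighbours, so shifting the weight
  of \<open>x\<^sub>0\<close> to \<open>z\<close> deforms the identity into a map that misses the vertex \<open>x\<^sub>0\<close>.\<close>

lemma automorphism_above_identity:
  assumes k: "digraph_hom G G k" and surj: "k ` V = V"
    and above: "\<And>a b. (a, b) \<in> arcs G \<Longrightarrow> (a, k b) \<in> arcs G"
    and x0: "x0 \<in> V"
  shows "k x0 = x0"
proof (rule ccontr)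
  define z where "z = k x0"
  assume "k x0 \<noteq> x0"
  then have zx: "z \<noteq> x0" by (simp add: z_def)
  have z: "z \<in> V" using x0 surj by (auto simp: z_def)
  have inj: "inj_on k V" by (rule bijective_hom_inverse(1)[OF k surj])
  have into_z: "(a, z) \<in> arcs G" if "(a, x0) \<in> arcs G" for a
    using above[OF that] by (simp add: z_def)
  \<comment> \<open>By \<open>above\<close>, \<open>k\<close> maps the finite set of out-neighbours
    of \<open>z\<close> injectively into itself, hence onto itself. This set contains
    \<open>k a\<close>, so by injectivity it contains \<open>a\<close>.\<close>
  have from_z: "(z, a) \<in> arcs G" if "(x0, a) \<in> arcs G" for a
  proof -
    let ?O = "{b. (z, b) \<in> arcs G}"
    have OV: "?O \<subseteq> V" using arcsV by auto
    have "k ` ?O = ?O"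
      by (rule endo_inj_surj) (use finite_subset[OF OV finV] above inj_on_subset[OF inj OV] in auto)
    moreover have "k a \<in> ?O" using k that by (auto simp: digraph_hom_def z_def)
    ultimately obtain b where b: "b \<in> ?O" "k a = k b" by (metis (no_types, lifting) imageE)
    moreover have "a \<in> V" using that arcsV by auto
    ultimately have "a = b" using inj OV by (metis (no_types, lifting) inj_onD subsetD)
    with b show ?thesis by simp
  qed
  define \<Phi> where "\<Phi> = (\<lambda>x. \<lambda>v\<in>V. if v = x0 then 0 else if v = z then x z + x x0 else (x v :: real))"
  have ext: "\<exists>S\<in>simplices G. z \<in> S \<and> {w \<in> V. x w \<noteq> 0} \<subseteq> S" if x: "x \<in> topspace X" "x x0 \<noteq> 0" for x
  proof -
    let ?S = "{w \<in> V. x w \<noteq> 0}"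
    have S: "?S \<in> simplices G" using x by (simp add: topspace_realisation)
    obtain r :: "'a \<Rightarrow> real" where r: "\<And>a b. a \<in> ?S \<Longrightarrow> b \<in> ?S \<Longrightarrow> r a \<le> r b \<Longrightarrow> (a, b) \<in> arcs G"
      using simplices_imp_ranking(4)[OF S] by blast
    have x0S: "x0 \<in> ?S" using x x0 by simp
    have zz: "(z, z) \<in> arcs G" using reflV[OF z] .
    have "insert z ?S \<in> simplices G"
    \<comment> \<open>\<open>z\<close> receives the rank of \<open>x0\<close>, so its arcs to and
      from the other vertices come from those of \<open>x0\<close> by \<open>from_z\<close> and
      \<open>into_z\<close>.\<close>
    proof (rule ranking_imp_simplices[where r = "r(z := r x0)"])
      show "finite (insert z ?S)" "insert z ?S \<noteq> {}" "insert z ?S \<subseteq> V" using finV z by auto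
      fix a b assume ab: "a \<in> insert z ?S" "b \<in> insert z ?S" "(r(z := r x0)) a \<le> (r(z := r x0)) b"
      show "(a, b) \<in> arcs G"
      proof (cases "a = z")
        case True
        show ?thesis
        proof (cases "b = z")
          case True then show ?thesis using \<open>a = z\<close> zz by simp
        next
          case False
          then have "(x0, b) \<in> arcs G" using ab True r[OF x0S, of b] by simp
          then show ?thesis using from_z True by simp
        qed
      next
        case a: False
        show ?thesis
        proof (cases "b = z")
          case True
          then have "(a, x0) \<in> arcs G" using ab a r[OF _ x0S, of a] by simp
          then show ?thesis using into_z True by simp
        next
          case False
          then show ?thesis using ab a r[of a b] by simp
        qed
      qed
    qed
    then show ?thesis by blast
  qed
  have \<Phi>_supp: "w = z \<and> x x0 \<noteq> 0 \<or> x w \<noteq> 0" if "w \<in> V" "\<Phi> x w \<noteq> 0" for x w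
    using that by (auto simp: \<Phi>_def split: if_splits)
  have carrier: "\<exists>S\<in>simplices G. \<forall>w\<in>V. x w \<noteq> 0 \<or> \<Phi> x w \<noteq> 0 \<longrightarrow> w \<in> S" if x: "x \<in> topspace X" for x
  proof (cases "x x0 = 0")
    case True
    have S: "{w \<in> V. x w \<noteq> 0} \<in> simplices G" using x by (simp add: topspace_realisation)
    have "w \<in> {w \<in> V. x w \<noteq> 0}" if "w \<in> V" "x w \<noteq> 0 \<or> \<Phi> x w \<noteq> 0" for w
      using \<Phi>_supp[OF that(1), of x] that True by auto
    then show ?thesis by (intro bexI[OF _ S] ballI impI)
  next
    case False
    then obtain S where S: "S \<in> simplices G" "z \<in> S" "{w \<in> V. x w \<noteq> 0} \<subseteq> S"
      using ext[OF x] by auto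
    have "w \<in> S" if "w \<in> V" "x w \<noteq> 0 \<or> \<Phi> x w \<noteq> 0" for w
      using \<Phi>_supp[OF that(1), of x] that S(2,3) by auto
    then show ?thesis by (intro bexI[OF _ S(1)] ballI impI)
  qed
  have \<Phi>: "continuous_map X X \<Phi>"
    unfolding continuous_map_into_realisation
  proof (intro conjI ballI)
    fix v assume "v \<in> V"
    then show "continuous_map X euclideanreal (\<lambda>x. \<Phi> x v)"
      using continuous_map_realisation_coordinate[of _ G] x0 z
      by (auto simp: \<Phi>_def intro!: continuous_map_add)
  next
    fix x assume x: "x \<in> topspace X"
    have nn: "\<Phi> x v \<ge> 0" if "v \<in> V" for v
      using x that x0 z by (simp add: \<Phi>_def topspace_realisation)
    have "(\<Sum>v\<in>V. \<Phi> x v) = (\<Sum>v\<in>V. x v + (if v = z then x x0 else 0) - (if v = x0 then x x0 else 0))"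
      by (rule sum.cong) (use zx in \<open>auto simp: \<Phi>_def\<close>)
    also have "\<dots> = (\<Sum>v\<in>V. x v)"
      using finV x0 z by (simp add: sum.distrib sum_subtractf)
    finally have sum1: "(\<Sum>v\<in>V. \<Phi> x v) = 1" using x by (simp add: topspace_realisation)
    obtain S where S: "S \<in> simplices G" "\<forall>w\<in>V. x w \<noteq> 0 \<or> \<Phi> x w \<noteq> 0 \<longrightarrow> w \<in> S"
      using carrier[OF x] by blast
    have "{w \<in> V. \<Phi> x w \<noteq> 0} \<noteq> {}"
    proof
      assume "{w \<in> V. \<Phi> x w \<noteq> 0} = {}"
      then have "(\<Sum>w\<in>V. \<Phi> x w) = 0" by (intro sum.neutral) blast
      with sum1 show False by simp
    qed
    then have "{w \<in> V. \<Phi> x w \<noteq> 0} \<in> simplices G"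
      using S by (intro simplices_subset[OF S(1)]) auto
    then show "\<Phi> x \<in> topspace X"
      using nn sum1 by (auto simp: topspace_realisation \<Phi>_def)
  qed
  have "homotopic_with (\<lambda>_. True) X X id \<Phi>"
    by (rule homotopic_realisation_linear[OF _ \<Phi>]) (use carrier in auto)
  moreover have "homotopic_with (\<lambda>_. True) X X \<Phi> (\<lambda>_. vertex_point G x0)"
  proof (rule nullhomotopic_missing_point[OF \<Phi> vertex_point_in[OF x0] _ vertex_point_in[OF x0]])
    fix x
    have "\<Phi> x x0 \<noteq> vertex_point G x0 x0" using x0 by (simp add: \<Phi>_def vertex_point_def)
    then show "\<Phi> x \<noteq> vertex_point G x0" by metis
  qed
  ultimately have "homotopic_with (\<lambda>_. True) X X id (\<lambda>_. vertex_point G x0)"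
    by (rule homotopic_with_trans)
  then show False using not_contractible unfolding contractible_space_def by blast
qed

text \<open>Let \<open>k\<close> be \<open>axis p f i y'\<close> followed by the inverse of
  \<open>axis p f i y\<close>. Applying \<open>f\<close> to an arc \<open>(b, d)\<close> in
  coordinate \<open>i\<close> and to the arcs from \<open>y\<close> to \<open>y'\<close> elsewhere
  yields an arc from \<open>b\<close> to \<open>k d\<close>. So \<open>k\<close> is an automorphism
  above the identity, hence the identity.\<close>

lemma surjective_axes_agree:
  assumes f: "polymorphism G p f" and y: "y \<in> {..<p} \<rightarrow> V" "y' \<in> {..<p} \<rightarrow> V"
    and arc: "\<And>j. j < p \<Longrightarrow> j \<noteq> i \<Longrightarrow> (y j, y' j) \<in> arcs G"
    and onto: "axis p f i y ` V = V" "axis p f i y' ` V = V"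
    and a: "a \<in> V"
  shows "axis p f i y a = axis p f i y' a"
proof -
  let ?g = "axis p f i y" and ?g' = "axis p f i y'"
  note hom = axis_hom[OF f y(1), of i] and hom' = axis_hom[OF f y(2), of i]
  note inj = bijective_hom_inverse(1)[OF hom onto(1)] and inv = bijective_hom_inverse(2)[OF hom onto(1)]
  define k where "k = (\<lambda>a. inv_into V ?g (?g' a))"
  have "digraph_hom G G k"
    using hom' inv by (auto simp: digraph_hom_def k_def)
  moreover have "k ` V = V"
  proof -
    have "k ` V = inv_into V ?g ` (?g' ` V)" by (auto simp: k_def)
    also have "\<dots> = inv_into V ?g ` (?g ` V)" using onto by simp
    also have "\<dots> = V" using inj by simp
    finally show ?thesis .
  qed
  moreover have "(b, k d) \<in> arcs G" if "(b, d) \<in> arcs G" for b d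
  proof -
    have "(?g b, ?g' d) \<in> arcs G"
      unfolding axis_def using that arc by (intro poly_hom(2)[OF f]) auto
    then have "(inv_into V ?g (?g b), k d) \<in> arcs G" using inv by (auto simp: digraph_hom_def k_def)
    moreover have "b \<in> V" using that arcsV by auto
    ultimately show ?thesis using inj by simp
  qed
  ultimately have "k a = a" using automorphism_above_identity a by blast
  moreover have "?g' a \<in> ?g ` V" using onto a by blast
  ultimately show ?thesis by (metis f_inv_into_f k_def)
qed

section \<open>Connectedness and dependence on a single coordinate\<close>

text \<open>The total weight on \<open>A\<close> is continuous on a connected space. With a vertex
  inside and one outside \<open>A\<close>, it would take the value 1/2. But vertices of one simplex
  are joined by arcs, so they lie all inside or all outside \<open>A\<close>.\<close>

lemma arc_closed_set_eq_verts:
  assumes A: "A \<subseteq> V" "A \<noteq> {}"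
    and closed: "\<And>a b. (a, b) \<in> arcs G \<Longrightarrow> a \<in> A \<longleftrightarrow> b \<in> A"
  shows "A = V"
proof (rule ccontr)
  assume "A \<noteq> V"
  then obtain b where b: "b \<in> V" "b \<notin> A" using A by blast
  obtain a where a: "a \<in> A" "a \<in> V" using A by blast
  define s where "s = (\<lambda>x. \<Sum>v\<in>A. x v :: real)"
  have finA: "finite A" using A finV finite_subset by blast
  have "continuous_map X euclideanreal s"
    unfolding s_def by (intro continuous_map_sum finA continuous_map_realisation_coordinate) (use A in auto)
  moreover have "connectedin X (topspace X)"
    using path_connected path_connected_imp_connected_space connectedin_topspace by blast
  ultimately have "connectedin euclideanreal (s ` topspace X)"
    by (rule connectedin_continuous_map_image)
  then have conn: "connected (s ` topspace X)" by simp
  have "s (vertex_point G a) = 1"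
    unfolding s_def using a A finA by (subst sum.remove[of _ a]) (auto simp: vertex_point_def intro!: sum.neutral)
  moreover have "s (vertex_point G b) = 0"
    unfolding s_def using b A by (intro sum.neutral) (auto simp: vertex_point_def)
  ultimately have "{0, 1} \<subseteq> s ` topspace X"
    using vertex_point_in a(2) b(1) by (metis empty_subsetI imageI insert_subset)
  then have "{0..1} \<subseteq> s ` topspace X" by (intro connected_contains_Icc[OF conn]) auto
  moreover have "1 / 2 \<in> {0..1::real}" by simp
  ultimately obtain x where x: "x \<in> topspace X" "s x = 1 / 2" by (metis imageE subsetD)
  let ?S = "{v \<in> V. x v \<noteq> 0}"
  have S: "?S \<in> simplices G" and sum1: "(\<Sum>v\<in>V. x v) = 1" using x(1) by (simp_all add: topspace_realisation)
  obtain r :: "'a \<Rightarrow> real" where r: "\<forall>a\<in>?S. \<forall>b\<in>?S. r a \<le> r b \<longrightarrow> (a, b) \<in> arcs G"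
    using simplices_imp_ranking(4)[OF S] by (rule exE)
  have same: "c \<in> A \<longleftrightarrow> d \<in> A" if "c \<in> ?S" "d \<in> ?S" for c d
    using r that closed[of c d] closed[of d c] by (cases "r c \<le> r d") auto
  show False
  proof (cases "?S \<inter> A = {}")
    case True
    then have "s x = 0" unfolding s_def using A by (intro sum.neutral) auto
    then show False using x by simp
  next
    case False
    then have "?S \<subseteq> A" using same by blast
    then have "s x = (\<Sum>v\<in>V. x v)" unfolding s_def using A finV by (intro sum.mono_neutral_left) auto
    then show False using x sum1 by simp
  qed
qed

text \<open>Changing one coordinate other than the \<open>i\<close>-th along an arc does not affect
  the value of \<open>f\<close>, and by connectedness neither does any change of it. These
  coordinates are then reset to one vertex, one at a time.\<close>

lemma essentially_unary_if_axes_surjective: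
  assumes f: "polymorphism G p f" and i: "i < p"
    and onto: "\<And>y. y \<in> {..<p} \<rightarrow> V \<Longrightarrow> axis p f i y ` V = V"
  shows "essentially_unary G p f"
proof -
  obtain v0 where v0: "v0 \<in> V" using neV by blast
  have upd: "f (restrict (w(j := c)) {..<p}) = f (restrict w {..<p})"
    if w: "w \<in> {..<p} \<rightarrow> V" and j: "j < p" "j \<noteq> i" and c: "c \<in> V" for w j c
  proof -
    have wV: "w(j := c) \<in> {..<p} \<rightarrow> V" if "c \<in> V" for c using w that by auto
    have ax: "axis p f i (w(j := c)) (w i) = f (restrict (w(j := c)) {..<p})" for c
      unfolding axis_def using j(2) by (intro arg_cong[of _ _ f]) auto
    have step: "f (restrict (w(j := c)) {..<p}) = f (restrict (w(j := d)) {..<p})"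
      if cd: "(c, d) \<in> arcs G" for c d
    proof -
      have cV: "c \<in> V" "d \<in> V" using cd arcsV by auto
      have "axis p f i (w(j := c)) (w i) = axis p f i (w(j := d)) (w i)"
      proof (rule surjective_axes_agree[OF f wV[OF cV(1)] wV[OF cV(2)] _ onto[OF wV[OF cV(1)]] onto[OF wV[OF cV(2)]]])
        show "((w(j := c)) l, (w(j := d)) l) \<in> arcs G" if "l < p" "l \<noteq> i" for l
          using that cd w by (auto simp: reflV Pi_iff)
        show "w i \<in> V" using w i by auto
      qed
      then show ?thesis unfolding ax .
    qed
    let ?A = "{c \<in> V. f (restrict (w(j := c)) {..<p}) = f (restrict w {..<p})}"
    have "?A = V"
    proof (rule arc_closed_set_eq_verts)
      have "w j \<in> ?A" using w j by auto
      then show "?A \<noteq> {}" by blast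
      show "a \<in> ?A \<longleftrightarrow> b \<in> ?A" if "(a, b) \<in> arcs G" for a b
        using step[OF that] that arcsV by auto
    qed auto
    then show ?thesis using c by blast
  qed
  define g where "g = axis p f i (\<lambda>_. v0)"
  have "digraph_hom G G g" unfolding g_def by (rule axis_hom[OF f]) (use v0 in auto)
  moreover have "f x = g (x i)" if x: "x \<in> verts (digraph_power G p)" for x
  proof -
    have xV: "x \<in> {..<p} \<rightarrow>\<^sub>E V" using x by (simp add: digraph_power_def)
    \<comment> \<open>The coordinates below \<open>k\<close> other than \<open>i\<close> have been
      reset to \<open>v0\<close>; at \<open>k = p\<close> the tuple lies on the axis that defines
      \<open>g\<close>.\<close>
    have "f (restrict (\<lambda>l. if l < k \<and> l \<noteq> i then v0 else x l) {..<p}) = f x" if "k \<le> p" for k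
      using that
    proof (induction k)
      case 0
      show ?case using PiE_restrict[OF xV] by simp
    next
      case (Suc k)
      let ?w = "\<lambda>l. if l < k \<and> l \<noteq> i then v0 else x l"
      have IH: "f (restrict ?w {..<p}) = f x" by (rule Suc.IH) (use Suc.prems in simp)
      show ?case
      proof (cases "k = i")
        case True
        then have "(\<lambda>l. if l < Suc k \<and> l \<noteq> i then v0 else x l) = ?w" by (auto simp: less_Suc_eq)
        then show ?thesis using IH by (simp only:)
      next
        case False
        then have eq: "(\<lambda>l. if l < Suc k \<and> l \<noteq> i then v0 else x l) = ?w(k := v0)" by (auto simp: less_Suc_eq)
        have w: "?w \<in> {..<p} \<rightarrow> V" by (rule Pi_I) (use PiE_mem[OF xV] v0 in simp)
        have "k < p" using Suc.prems by simp
        from upd[OF w this False v0] show ?thesis unfolding eq IH .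
      qed
    qed
    from this[OF order_refl, symmetric]
    have "f x = f (restrict (\<lambda>l. if l < p \<and> l \<noteq> i then v0 else x l) {..<p})" .
    also have "\<dots> = g (x i)" unfolding g_def axis_def by (intro arg_cong[of _ _ f]) auto
    finally show ?thesis .
  qed
  ultimately show ?thesis using i unfolding essentially_unary_def by blast
qed

end

theorem theorem3p3:
  fixes G :: "'a digraph" and n :: nat
  assumes "n \<ge> 1"
    and "refl_digraph G"
    and "triangulates G (nsphere n)"
    and "\<And>p f. p \<ge> 2 \<Longrightarrow> surjective_polymorphism G p f \<Longrightarrow>
           \<exists>e. digraph_embedding G (digraph_power G p) e \<and> f ` (e ` verts G) = verts G"
  shows "slupecki G"
  unfolding slupecki_def k_slupecki_def
proof (intro allI impI)
  interpret sphere_digraph G n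
    using assms(1-3) by unfold_locales (simp_all add: triangulates_def)
  fix p :: nat and f assume p: "2 \<le> p" and sf: "surjective_polymorphism G p f"
  then have f: "polymorphism G p f" by (simp add: surjective_polymorphism_def)
  obtain e where e: "digraph_hom G (digraph_power G p) e" and onto: "f ` (e ` V) = V"
    using assms(4)[OF p sf] by (auto simp: digraph_embedding_def)
  have eV: "e v \<in> {..<p} \<rightarrow>\<^sub>E V" if "v \<in> V" for v
    using e that by (auto simp: digraph_hom_def digraph_power_def)
  \<comment> \<open>Arcs of the power are defined coordinatewise, so the coordinates of
    \<open>e\<close> are endomorphisms of \<open>G\<close>; with \<open>onto\<close> they form the
    family to which \<open>exists_surjective_axis\<close> applies.\<close>
  have hom: "digraph_hom G G (\<lambda>v. e v i)" if "i < p" for i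
    using e that eV by (auto simp: digraph_hom_def digraph_power_def)
  have "(\<lambda>v. f (\<lambda>i\<in>{..<p}. e v i)) ` V = f ` (e ` V)"
    unfolding image_image by (rule image_cong) (use PiE_restrict[OF eV] in auto)
  then have "(\<lambda>v. f (\<lambda>i\<in>{..<p}. e v i)) ` V = V" using onto by simp
  from exists_surjective_axis[where e = "\<lambda>i v. e v i", OF f hom this]
  obtain i where i: "i < p" and ax: "\<forall>y\<in>{..<p} \<rightarrow> V. axis p f i y ` V = V"
    by auto
  show "essentially_unary G p f"
    by (rule essentially_unary_if_axes_surjective[OF f i bspec[OF ax]])
qed

end
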